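(* For all $(m,n)\in\mathbb{Z}_{\ge0}^2\setminus\{(0,0)\}$ and all $\mathbf{a}=(a_1,\dots,a_m;b_1,\dots,b_m;c_1,\dots,c_n)\in I_{m,n}$, we have $Z_{\mathcal{A}}(z_{\mathbf{a}})=\bar{Z}_{\mathcal{A}}(z_{\mathbf{a}})=0$.
   Context: Let $\mathcal{A}=\bigl(\prod_{p}\mathbb{Z}/p\mathbb{Z}\bigr)/\bigl(\bigoplus_{p}\mathbb{Z}/p\mathbb{Z}\bigr)$, $p$ over all primes (a $\mathbb{Q}$-algebra; families agreeing for all but finitely many $p$ are identified). For positive integers $k_1,\dots,k_n$ let $\zeta_{\mathcal{A}}(k_1,\dots,k_n)=\bigl(\sum_{p>m_1>\dots>m_n\ge1} m_1^{-k_1}\cdots m_n^{-k_n}\bmod p\bigr)_p$ and $\zeta^{\star}_{\mathcal{A}}(k_1,\dots,k_n)$ the same with $p>m_1\ge\dots\ge m_n\ge1$. Let $\mathfrak{H}^1=\mathbb{Q}\langle z_1,z_2,\dots\rangle$ be the noncommutative polynomial algebra in countably many variables. The shuffle product $\sqcup\!\sqcup$ on $\mathfrak{H}^1$ is the $\mathbb{Q}$-bilinear map defined inductively by $1\sqcup\!\sqcup w=w\sqcup\!\sqcup 1=w$ and $z_kw\sqcup\!\sqcup z_{k'}w'=z_k(w\sqcup\!\sqcup z_{k'}w')+z_{k'}(z_kw\sqcup\!\sqcup w')$ for words $w,w'$ and $k,k'\ge1$. Let $Z_{\mathcal{A}},\bar Z_{\mathcal{A}}:\mathfrak{H}^1\to\mathcal{A}$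 be the $\mathbb{Q}$-linear maps with $Z_{\mathcal{A}}(1)=\bar Z_{\mathcal{A}}(1)=1$, $Z_{\mathcal{A}}(z_{k_1}\cdots z_{k_l})=\zeta_{\mathcal{A}}(k_1,\dots,k_l)$, $\bar Z_{\mathcal{A}}(z_{k_1}\cdots z_{k_l})=\zeta^\star_{\mathcal{A}}(k_1,\dots,k_l)$. For $(m,n)\in\mathbb{Z}_{\ge0}^2\setminus\{(0,0)\}$, $I_{m,n}$ is the set of all tuples $\mathbf{a}=(a_1,\dots,a_m;b_1,\dots,b_m;c_1,\dots,c_n)$ with $a_i,b_i$ odd positive integers and $c_j$ even positive integers, and $z_{\mathbf{a}}=\sum_{\sigma,\tau\in S_m} z_{a_{\sigma(1)}}z_{b_{\tau(1)}}\cdots z_{a_{\sigma(m)}}z_{b_{\tau(m)}}\sqcup\!\sqcup z_{c_1}\sqcup\!\sqcup\cdots\sqcup\!\sqcup z_{c_n}\in\mathfrak{H}^1$, where $S_m$ is the symmetric group of degree $m$. *)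

theory Defs
  imports
    Complex_Main
    "HOL-Number_Theory.Modular_Inverse"
    "HOL-Library.Poly_Mapping"
    "HOL-Combinatorics.Permutations"
begin

section \<open>The ring \<open>\<A>\<close>\<close>

text \<open>
  An element of \<open>\<Prod>\<^sub>p \<int>/p\<int>\<close> is represented by a family of integers \<open>f\<close>, where \<open>f p\<close> stands for its
  residue class modulo \<open>p\<close>; the values of \<open>f\<close> at non-primes are irrelevant. A single quotient
  therefore passes to residue classes and divides by \<open>\<Oplus>\<^sub>p \<int>/p\<int>\<close>.
\<close>

definition A_rel :: "(nat \<Rightarrow> int) \<Rightarrow> (nat \<Rightarrow> int) \<Rightarrow> bool" where
  "A_rel f g \<longleftrightarrow> finite {p. prime p \<and> \<not> [f p = g p] (mod int p)}"

lemma A_rel_weaken: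
  assumes "A_rel f g" and "\<And>p. prime p \<Longrightarrow> [f p = g p] (mod int p) \<Longrightarrow> [f' p = g' p] (mod int p)"
  shows "A_rel f' g'"
  using assms unfolding A_rel_def by (auto elim!: rev_finite_subset)

lemma A_rel_weaken2:
  assumes "A_rel f g" "A_rel f' g'"
    and "\<And>p. prime p \<Longrightarrow> [f p = g p] (mod int p) \<Longrightarrow> [f' p = g' p] (mod int p) \<Longrightarrow>
               [f'' p = g'' p] (mod int p)"
  shows "A_rel f'' g''"
proof -
  have "finite ({p. prime p \<and> \<not> [f p = g p] (mod int p)} \<union> {p. prime p \<and> \<not> [f' p = g' p] (mod int p)})"
    using assms(1,2) unfolding A_rel_def by simp
  then show ?thesis
    unfolding A_rel_def by (rule rev_finite_subset) (use assms(3) in blast)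
qed

lemma A_rel_refl: "A_rel f f"
  by (simp add: A_rel_def)

quotient_type A_ring = "nat \<Rightarrow> int" / A_rel
  morphisms rep_A family_A
proof (rule equivpI)
  show "reflp A_rel" by (simp add: reflp_def A_rel_refl)
  show "symp A_rel" unfolding symp_def using A_rel_weaken cong_sym by blast
  show "transp A_rel" unfolding transp_def using A_rel_weaken2 cong_trans by blast
qed

instantiation A_ring :: comm_ring_1
begin

lift_definition zero_A_ring :: A_ring is "\<lambda>p. 0" .
lift_definition one_A_ring :: A_ring is "\<lambda>p. 1" .
lift_definition plus_A_ring :: "A_ring \<Rightarrow> A_ring \<Rightarrow> A_ring" is "\<lambda>f g p. f p + g p"
  by (erule (1) A_rel_weaken2, rule cong_add)
lift_definition times_A_ring :: "A_ring \<Rightarrow> A_ring \<Rightarrow> A_ring" is "\<lambda>f g p. f p * g p"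
  by (erule (1) A_rel_weaken2, rule cong_mult)
lift_definition uminus_A_ring :: "A_ring \<Rightarrow> A_ring" is "\<lambda>f p. - f p"
  by (erule A_rel_weaken, simp add: cong_minus_minus_iff)
lift_definition minus_A_ring :: "A_ring \<Rightarrow> A_ring \<Rightarrow> A_ring" is "\<lambda>f g p. f p - g p"
  by (erule (1) A_rel_weaken2, rule cong_diff)

instance
proof
  have "\<not> [0 = 1] (mod int p)" if "prime p" for p
    using prime_gt_1_nat[OF that] by (simp add: cong_def)
  then have "{p::nat. prime p \<and> \<not> [0 = 1] (mod int p)} = {p. prime p}"
    by blast
  then have "\<not> A_rel (\<lambda>p. 0) (\<lambda>p. 1)"
    using primes_infinite by (simp add: A_rel_def)
  then show "(0 :: A_ring) \<noteq> 1"
    by transfer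
qed (transfer, simp add: A_rel_refl algebra_simps)+

end

text \<open>
  The class of a rational number modulo \<open>p\<close>; the primes dividing the denominator, where
  \<^const>\<open>modular_inverse\<close> takes the dummy value \<open>0\<close>, are finite in number and do not
  matter in \<open>\<A>\<close>.
\<close>

definition rat_mod :: "rat \<Rightarrow> nat \<Rightarrow> int" where
  "rat_mod r p = fst (quotient_of r) * modular_inverse (int p) (snd (quotient_of r))"

lift_definition scale_A :: "rat \<Rightarrow> A_ring \<Rightarrow> A_ring" is "\<lambda>r f p. rat_mod r p * f p"
  by (erule A_rel_weaken, rule cong_mult[OF cong_refl])

lemma A_rel_cancelI:
  assumes "d \<noteq> 0"
    and "\<And>p. prime p \<Longrightarrow> \<not> int p dvd d \<Longrightarrow> [d * f p = d * g p] (mod int p)"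
  shows "A_rel f g"
proof -
  have "p \<le> nat \<bar>d\<bar>" if "prime p" "\<not> [f p = g p] (mod int p)" for p
  proof -
    have "int p dvd d"
    proof (rule ccontr)
      assume *: "\<not> int p dvd d"
      with that(1) have "coprime d (int p)"
        by (metis coprime_commute prime_imp_coprime prime_nat_int_transfer)
      with assms(2)[OF that(1) *] that(2) show False
        by (simp add: cong_mult_lcancel)
    qed
    with assms(1) have "\<bar>int p\<bar> \<le> \<bar>d\<bar>"
      by (rule dvd_imp_le_int)
    then show ?thesis by simp
  qed
  then show ?thesis
    unfolding A_rel_def by (auto intro: finite_subset[of _ "{..nat \<bar>d\<bar>}"])
qed

lemma rat_mod_cong:
  assumes "prime p" "\<not> int p dvd snd (quotient_of r)"
  shows "[snd (quotient_of r) * rat_mod r p = fst (quotient_of r)] (mod int p)"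
proof -
  have "coprime (snd (quotient_of r)) (int p)"
    using assms by (metis coprime_commute prime_imp_coprime prime_nat_int_transfer)
  then have "[fst (quotient_of r) * (snd (quotient_of r) * modular_inverse (int p) (snd (quotient_of r)))
              = fst (quotient_of r) * 1] (mod int p)"
    by (intro cong_mult cong_refl cong_modular_inverse1)
  then show ?thesis by (simp add: rat_mod_def mult_ac)
qed

lemma rat_mod_hom:
  shows "A_rel (rat_mod (r + s)) (\<lambda>p. rat_mod r p + rat_mod s p)" (is ?add)
    and "A_rel (rat_mod (r * s)) (\<lambda>p. rat_mod r p * rat_mod s p)" (is ?mult)
proof -
  define N D where "N x = fst (quotient_of x)" and "D x = snd (quotient_of x)" for x
  have D0: "D x \<noteq> 0" for x
    using quotient_of_denom_pos'[of x] by (simp add: D_def)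
  have ND: "of_int (D x) * x = (of_int (N x) :: rat)" for x
  proof -
    have "quotient_of x = (N x, D x)"
      by (simp add: N_def D_def)
    then have "of_int (D x) * x = of_int (D x) * (of_int (N x) / of_int (D x))"
      by (rule arg_cong[OF quotient_of_div])
    also have "\<dots> = of_int (N x)"
      using D0[of x] by simp
    finally show ?thesis .
  qed
  have c: "[D x * rat_mod x p = N x] (mod int p)" if "prime p" "\<not> int p dvd D x" for p x
    using rat_mod_cong that unfolding N_def D_def by blast
  show ?add
  proof (rule A_rel_cancelI[of "D (r + s) * D r * D s"])
    fix p :: nat
    assume p: "prime p" and "\<not> int p dvd D (r + s) * D r * D s"
    then have nd: "\<not> int p dvd D (r + s)" "\<not> int p dvd D r" "\<not> int p dvd D s"
      by auto
    have "(of_int (N (r + s) * (D r * D s)) :: rat) = of_int (D (r + s) * (N r * D s + N s * D r))"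
      unfolding of_int_mult of_int_add ND[symmetric] by (simp add: algebra_simps)
    then have e: "N (r + s) * (D r * D s) = D (r + s) * (N r * D s + N s * D r)"
      using of_int_eq_iff by blast
    have "[(D (r + s) * rat_mod (r + s) p) * (D r * D s) = N (r + s) * (D r * D s)] (mod int p)"
      by (intro cong_mult cong_refl c p nd)
    also have "[N (r + s) * (D r * D s) =
        D (r + s) * ((D r * rat_mod r p) * D s + (D s * rat_mod s p) * D r)] (mod int p)"
      unfolding e by (intro cong_mult cong_add cong_refl cong_sym[OF c] p nd)
    finally show "[D (r + s) * D r * D s * rat_mod (r + s) p =
        D (r + s) * D r * D s * (rat_mod r p + rat_mod s p)] (mod int p)"
      by (simp add: algebra_simps)
  qed (simp add: D0)
  show ?mult
  proof (rule A_rel_cancelI[of "D (r * s) * D r * D s"])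
    fix p :: nat
    assume p: "prime p" and "\<not> int p dvd D (r * s) * D r * D s"
    then have nd: "\<not> int p dvd D (r * s)" "\<not> int p dvd D r" "\<not> int p dvd D s"
      by auto
    have "(of_int (N (r * s) * (D r * D s)) :: rat) = of_int (D (r * s) * (N r * N s))"
      unfolding of_int_mult ND[symmetric] by (simp add: algebra_simps)
    then have e: "N (r * s) * (D r * D s) = D (r * s) * (N r * N s)"
      using of_int_eq_iff by blast
    have "[(D (r * s) * rat_mod (r * s) p) * (D r * D s) = N (r * s) * (D r * D s)] (mod int p)"
      by (intro cong_mult cong_refl c p nd)
    also have "[N (r * s) * (D r * D s) =
        D (r * s) * ((D r * rat_mod r p) * (D s * rat_mod s p))] (mod int p)"
      unfolding e by (intro cong_mult cong_refl cong_sym[OF c] p nd)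
    finally show "[D (r * s) * D r * D s * rat_mod (r * s) p =
        D (r * s) * D r * D s * (rat_mod r p * rat_mod s p)] (mod int p)"
      by (simp add: algebra_simps)
  qed (simp add: D0)
qed

lemma scale_A_distrib_left: "scale_A r (x + y) = scale_A r x + scale_A r y"
  by transfer (simp add: A_rel_refl algebra_simps)

lemma scale_A_distrib_right: "scale_A (r + s) x = scale_A r x + scale_A s x"
proof -
  have "A_rel (\<lambda>p. rat_mod (r + s) p * f p) (\<lambda>p. rat_mod r p * f p + rat_mod s p * f p)" for f
    by (rule A_rel_weaken[OF rat_mod_hom(1)[of r s]])
      (metis cong_scalar_right distrib_right)
  then show ?thesis
    by (induct x) (simp add: scale_A.abs_eq plus_A_ring.abs_eq A_ring.abs_eq_iff)
qed

lemma scale_A_scale: "scale_A r (scale_A s x) = scale_A (r * s) x"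
proof -
  have "A_rel (\<lambda>p. rat_mod r p * (rat_mod s p * f p)) (\<lambda>p. rat_mod (r * s) p * f p)" for f
    by (rule A_rel_weaken[OF rat_mod_hom(2)[of r s]])
      (metis cong_scalar_right cong_sym mult.assoc)
  then show ?thesis
    by (induct x) (simp add: scale_A.abs_eq A_ring.abs_eq_iff)
qed

lemma scale_A_one: "scale_A 1 x = x"
proof -
  have "modular_inverse (int p) 1 = 1" if "prime p" for p
    using prime_gt_1_nat[OF that] by simp
  then have "A_rel (\<lambda>p. rat_mod 1 p * f p) f" for f
    by (intro A_rel_cancelI[of 1]) (simp_all add: rat_mod_def)
  then show ?thesis
    by (induct x) (simp add: scale_A.abs_eq A_ring.abs_eq_iff)
qed

global_interpretation A_space: vector_space scale_A
  by standard
    (rule scale_A_distrib_left scale_A_distrib_right scale_A_scale scale_A_one)+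

lemma scale_A_mult_left: "scale_A r x * y = scale_A r (x * y)"
  by transfer (simp add: A_rel_refl mult.assoc)


section \<open>Multiple zeta values in \<open>\<A>\<close>\<close>

typedef pnat = "{k :: nat. 0 < k}"
  morphisms nat_of_pnat pnat_of_nat
  by (rule exI[of _ 1]) simp

definition harm_term :: "nat \<Rightarrow> pnat list \<Rightarrow> nat list \<Rightarrow> int" where
  "harm_term p ks ms =
     (\<Prod>i<length ks. modular_inverse (int p) (int (ms ! i)) ^ nat_of_pnat (ks ! i))"

definition zeta_A :: "pnat list \<Rightarrow> A_ring" where
  "zeta_A ks = family_A (\<lambda>p.
     \<Sum>ms | length ms = length ks \<and> sorted_wrt (>) ms \<and> set ms \<subseteq> {1..<p}. harm_term p ks ms)"

definition zeta_star_A :: "pnat list \<Rightarrow> A_ring" where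
  "zeta_star_A ks = family_A (\<lambda>p.
     \<Sum>ms | length ms = length ks \<and> sorted_wrt (\<ge>) ms \<and> set ms \<subseteq> {1..<p}. harm_term p ks ms)"


section \<open>The algebra \<open>\<HH>\<^sup>1\<close> and the shuffle product\<close>

text \<open>
  The free monoid on \<open>'a\<close> is written additively because the convolution product on \<open>'m \<Rightarrow>\<^sub>0 rat\<close> is
  defined for additively written monoids \<open>'m\<close>; thus \<open>'a word \<Rightarrow>\<^sub>0 rat\<close> is the noncommutative
  polynomial algebra, with concatenation as product.
\<close>

datatype 'a word = Word (letters: "'a list")

instantiation word :: (type) monoid_add
begin

definition zero_word :: "'a word" where "0 = Word []"
definition plus_word :: "'a word \<Rightarrow> 'a word \<Rightarrow> 'a word" where
  "u + v = Word (letters u @ letters v)"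

instance
  by standard (simp_all add: zero_word_def plus_word_def)

end

type_synonym H1 = "pnat word \<Rightarrow>\<^sub>0 rat"

definition word_mon :: "pnat list \<Rightarrow> H1" where
  "word_mon ks = Poly_Mapping.single (Word ks) 1"

definition gen_z :: "pnat \<Rightarrow> H1" where
  "gen_z k = word_mon [k]"

definition scale_H1 :: "rat \<Rightarrow> H1 \<Rightarrow> H1" where
  "scale_H1 r x = Poly_Mapping.map ((*) r) x"

fun shuffle_words :: "pnat list \<Rightarrow> pnat list \<Rightarrow> H1" where
  "shuffle_words [] w = word_mon w"
| "shuffle_words w [] = word_mon w"
| "shuffle_words (k # w) (k' # w') =
     gen_z k * shuffle_words w (k' # w') + gen_z k' * shuffle_words (k # w) w'"

definition shuffle :: "H1 \<Rightarrow> H1 \<Rightarrow> H1" (infixl "\<squnion>\<squnion>" 70) where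
  "x \<squnion>\<squnion> y = (\<Sum>u\<in>Poly_Mapping.keys x. \<Sum>v\<in>Poly_Mapping.keys y.
     scale_H1 (Poly_Mapping.lookup x u * Poly_Mapping.lookup y v)
       (shuffle_words (letters u) (letters v)))"

lemma shuffle_word_mon: "word_mon u \<squnion>\<squnion> word_mon v = shuffle_words u v"
proof -
  have "scale_H1 1 x = x" for x
    by (rule poly_mapping_eqI) (simp add: scale_H1_def Poly_Mapping.map.rep_eq when_def)
  then show ?thesis
    by (simp add: shuffle_def word_mon_def)
qed


section \<open>The maps \<open>Z\<close> and \<open>Z_bar\<close>\<close>

definition linear_ext :: "(pnat list \<Rightarrow> A_ring) \<Rightarrow> H1 \<Rightarrow> A_ring" where
  "linear_ext f x = (\<Sum>w\<in>Poly_Mapping.keys x. scale_A (Poly_Mapping.lookup x w) (f (letters w)))"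

text \<open>
  On the empty word both values are \<open>1\<close>: the sums defining \<open>zeta_A []\<close> and \<open>zeta_star_A []\<close> have the
  empty tuple as their only index.
\<close>

definition Z_A :: "H1 \<Rightarrow> A_ring" where
  "Z_A = linear_ext zeta_A"

definition Zbar_A :: "H1 \<Rightarrow> A_ring" where
  "Zbar_A = linear_ext zeta_star_A"

lemma linear_ext_word_mon: "linear_ext f (word_mon ks) = f ks"
  by (simp add: linear_ext_def word_mon_def)

lemma Z_A_one: "Z_A 1 = 1" and Zbar_A_one: "Zbar_A 1 = 1"
proof -
  have "(1 :: H1) = word_mon []"
    by (simp add: word_mon_def zero_word_def[symmetric])
  moreover have "zeta_A [] = 1" "zeta_star_A [] = 1"
  proof -
    have "{ms :: nat list. length ms = length ([] :: pnat list) \<and> sorted_wrt R ms \<and> set ms \<subseteq> {1..<p}} = {[]}"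
      for R and p :: nat by auto
    then show "zeta_A [] = 1" "zeta_star_A [] = 1"
      by (simp_all add: zeta_A_def zeta_star_A_def harm_term_def one_A_ring.abs_eq del: length_0_conv)
  qed
  ultimately show "Z_A 1 = 1" "Zbar_A 1 = 1"
    by (metis Z_A_def Zbar_A_def linear_ext_word_mon)+
qed

lemma linear_ext_superset:
  assumes "finite S" "Poly_Mapping.keys x \<subseteq> S"
  shows "linear_ext f x = (\<Sum>w\<in>S. scale_A (Poly_Mapping.lookup x w) (f (letters w)))"
  unfolding linear_ext_def using assms
  by (intro sum.mono_neutral_left) (auto simp: in_keys_iff)

lemma linear_ext_add: "linear_ext f (x + y) = linear_ext f x + linear_ext f y"
proof -
  let ?S = "Poly_Mapping.keys x \<union> Poly_Mapping.keys y"
  have "Poly_Mapping.keys (x + y) \<subseteq> ?S" by (rule Poly_Mapping.keys_add)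
  then show ?thesis
    by (simp add: linear_ext_superset[of ?S] lookup_add A_space.scale_left_distrib sum.distrib)
qed

lemma linear_ext_scale: "linear_ext f (scale_H1 r x) = scale_A r (linear_ext f x)"
proof -
  have l: "Poly_Mapping.lookup (scale_H1 r x) w = r * Poly_Mapping.lookup x w" for w
    by (simp add: scale_H1_def Poly_Mapping.map.rep_eq when_def)
  then have "Poly_Mapping.keys (scale_H1 r x) \<subseteq> Poly_Mapping.keys x"
    by (auto simp: in_keys_iff)
  then show ?thesis
    by (simp add: linear_ext_superset[of "Poly_Mapping.keys x"] l A_space.scale_sum_right)
qed


section \<open>The elements \<open>z\<^sub>a\<close>\<close>

definition I_set :: "nat \<Rightarrow> nat \<Rightarrow> (pnat list \<times> pnat list \<times> pnat list) set" where
  "I_set m n = {(a, b, c). length a = m \<and> length b = m \<and> length c = n \<and>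
     (\<forall>k\<in>set a. odd (nat_of_pnat k)) \<and> (\<forall>k\<in>set b. odd (nat_of_pnat k)) \<and>
     (\<forall>k\<in>set c. even (nat_of_pnat k))}"

text \<open>Indices are shifted by one: \<open>S\<^sub>m\<close> acts on \<open>{..<m}\<close>, the positions of a list of length \<open>m\<close>.\<close>

fun z_tuple :: "pnat list \<times> pnat list \<times> pnat list \<Rightarrow> H1" where
  "z_tuple (a, b, c) =
     foldl (\<squnion>\<squnion>)
       (\<Sum>\<sigma> | \<sigma> permutes {..<length a}. \<Sum>\<tau> | \<tau> permutes {..<length a}.
          prod_list (map (\<lambda>i. gen_z (a ! \<sigma> i) * gen_z (b ! \<tau> i)) [0..<length a]))
       (map gen_z c)"

end

theory Submission
  imports Defs "HOL-Combinatorics.Multiset_Permutations"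
begin

text \<open>
  The element \<open>z\<^sub>a\<close> is the sum of all arrangements of the letters \<open>a\<^sub>i, b\<^sub>i, c\<^sub>j\<close> in which the \<open>a\<close>'s
  and \<open>b\<close>'s alternate, starting with an \<open>a\<close> and ending with a \<open>b\<close>. Modulo \<open>p = 2h + 1\<close>, its image is
  therefore the multilinear coefficient of the diagonal entry of \<open>M(p-1) \<cdots> M(1)\<close>, where
  \<open>M(m) = ((1 + C, X), (Y, 1 + C))\<close> with \<open>X = \<Sum> x\<^sub>i m\<^bsup>-a\<^sub>i\<^esup>\<close>, \<open>Y = \<Sum> y\<^sub>i m\<^bsup>-b\<^sub>i\<^esup>\<close>,
  \<open>C = \<Sum> t\<^sub>j m\<^bsup>-c\<^sub>j\<^esup>\<close>. By parity \<open>M(p-m) M(m)\<close> is congruent to the scalar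
  \<open>D(m) = (1 + C)\<^sup>2 - XY\<close>, so the whole product is the scalar \<open>D(1) \<cdots> D(h)\<close>. Since \<open>D(p-m) = D(m)\<close>, this
  scalar is unchanged when every \<open>m\<close> is replaced by \<open>2m\<close>, while its coefficients of weight \<open>k\<close> get multiplied
  by \<open>2\<^bsup>-k\<^esup>\<close>; hence they vanish once \<open>p > 2\<^sup>k\<close>. The starred sums are the coefficients of the inverse
  of the analogous product with \<open>C, X, Y\<close> negated, which is congruent to 1 as well.
\<close>

subsection \<open>Alternating arrangements\<close>

text \<open>
  The labels \<open>(Some True, i)\<close>, \<open>(Some False, i)\<close>, \<open>(None, j)\<close> stand for the letters with indices
  \<open>a\<^sub>i\<close>, \<open>b\<^sub>i\<close>, \<open>c\<^sub>j\<close>; the state \<open>s\<close> says that the next letter other than a \<open>c\<^sub>j\<close> is an \<open>a\<^sub>i\<close>.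
\<close>

type_synonym label = "bool option \<times> nat"

fun alternating :: "bool \<Rightarrow> label list \<Rightarrow> bool" where
  "alternating s [] \<longleftrightarrow> s"
| "alternating s (l # ls) \<longleftrightarrow>
     (case fst l of None \<Rightarrow> alternating s ls | Some t \<Rightarrow> t = s \<and> alternating (\<not> s) ls)"

definition arrangements :: "label set \<Rightarrow> bool \<Rightarrow> label list set" where
  "arrangements S s = {ls \<in> permutations_of_set S. alternating s ls}"

lemma finite_arrangements [simp]: "finite (arrangements S s)"
  by (simp add: arrangements_def)

lemma arrangements_empty [simp]: "arrangements {} s = (if s then {[]} else {})"
  by (auto simp: arrangements_def)

lemma arrangements_rec:
  assumes "S \<noteq> {}"
  shows "arrangements S s =
    (\<Union>l\<in>{l\<in>S. fst l = None}. (#) l ` arrangements (S - {l}) s) \<union>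
    (\<Union>l\<in>{l\<in>S. fst l = Some s}. (#) l ` arrangements (S - {l}) (\<not> s))"
proof (rule set_eqI)
  fix ls
  show "ls \<in> arrangements S s \<longleftrightarrow> ls \<in>
    (\<Union>l\<in>{l\<in>S. fst l = None}. (#) l ` arrangements (S - {l}) s) \<union>
    (\<Union>l\<in>{l\<in>S. fst l = Some s}. (#) l ` arrangements (S - {l}) (\<not> s))"
    using assms by (cases ls)
      (auto simp: arrangements_def permutations_of_set_def image_iff split: option.splits)
qed

text \<open>Splitting off the first letter: a neutral letter keeps the state, a letter of type
  \<open>Some s\<close> flips it. The later arguments about arrangements rest on this
  recursion.\<close>

lemma sum_arrangements_rec:
  fixes g :: "label list \<Rightarrow> 'a :: comm_monoid_add"
  assumes "finite S" "S \<noteq> {}"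
  shows "(\<Sum>ls\<in>arrangements S s. g ls) =
    (\<Sum>l | l \<in> S \<and> fst l = None. \<Sum>ls\<in>arrangements (S - {l}) s. g (l # ls)) +
    (\<Sum>l | l \<in> S \<and> fst l = Some s. \<Sum>ls\<in>arrangements (S - {l}) (\<not> s). g (l # ls))"
proof -
  have part: "(\<Sum>ls\<in>(\<Union>l\<in>K. (#) l ` arrangements (S - {l}) t). g ls) =
      (\<Sum>l\<in>K. \<Sum>ls\<in>arrangements (S - {l}) t. g (l # ls))" if "finite K" for K t
  proof (subst sum.UNION_disjoint)
    show "(\<Sum>l\<in>K. sum g ((#) l ` arrangements (S - {l}) t)) =
        (\<Sum>l\<in>K. \<Sum>ls\<in>arrangements (S - {l}) t. g (l # ls))"
      by (simp add: sum.reindex)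
  qed (use that in auto)
  show ?thesis
    unfolding arrangements_rec[OF assms(2)]
    by (subst sum.union_disjoint) (use assms(1) in \<open>auto simp: part\<close>)
qed

subsection \<open>The elements \<open>z_tuple\<close> as sums of words\<close>

lemma gen_z_mult_word_mon: "gen_z k * word_mon w = word_mon (k # w)"
  by (simp add: gen_z_def word_mon_def mult_single plus_word_def)

lemma lookup_scale_H1: "Poly_Mapping.lookup (scale_H1 r x) w = r * Poly_Mapping.lookup x w"
  by (simp add: scale_H1_def Poly_Mapping.map.rep_eq when_def)

lemma scale_H1_0 [simp]: "scale_H1 0 x = 0"
  by (rule poly_mapping_eqI) (simp add: lookup_scale_H1)

lemma shuffle_add_left: "(x + y) \<squnion>\<squnion> z = x \<squnion>\<squnion> z + y \<squnion>\<squnion> z"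
proof -
  \<comment> \<open>The sums run over different key sets; enlarging these to a common finite set
    only adds terms with coefficient 0.\<close>
  have sup: "u \<squnion>\<squnion> z = (\<Sum>v\<in>S. \<Sum>w\<in>Poly_Mapping.keys z.
      scale_H1 (Poly_Mapping.lookup u v * Poly_Mapping.lookup z w)
        (shuffle_words (letters v) (letters w)))"
    if "finite S" "Poly_Mapping.keys u \<subseteq> S" for u S
    unfolding shuffle_def using that
    by (intro sum.mono_neutral_left)
      (auto simp: in_keys_iff)
  let ?S = "Poly_Mapping.keys x \<union> Poly_Mapping.keys y"
  have "scale_H1 (r + s) u = scale_H1 r u + scale_H1 s u" for r s u
    by (rule poly_mapping_eqI) (simp add: lookup_scale_H1 lookup_add algebra_simps)
  moreover have "Poly_Mapping.keys (x + y) \<subseteq> ?S"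
    by (rule Poly_Mapping.keys_add)
  ultimately show ?thesis
    by (simp add: sup[of ?S] lookup_add distrib_right sum.distrib)
qed

lemma shuffle_sum_left: "(\<Sum>i\<in>I. f i) \<squnion>\<squnion> z = (\<Sum>i\<in>I. f i \<squnion>\<squnion> z)"
proof (induction I rule: infinite_finite_induct)
  case (insert i I)
  then show ?case by (simp add: shuffle_add_left)
qed (simp_all add: shuffle_def)

text \<open>Shuffling with one letter inserts it at every position, and a neutral letter may stand
  anywhere without disturbing the alternation. The induction removes the first letter of the
  arrangement.\<close>

lemma sum_shuffle_letter:
  assumes "finite S" "c \<notin> S" "fst c = None"
  shows "(\<Sum>ls\<in>arrangements S s. word_mon (map wt ls)) \<squnion>\<squnion> gen_z (wt c) =
    (\<Sum>ls\<in>arrangements (insert c S) s. word_mon (map wt ls))"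
proof -
  have "(\<Sum>ls\<in>arrangements S s. shuffle_words (map wt ls) [wt c]) =
    (\<Sum>ls\<in>arrangements (insert c S) s. word_mon (map wt ls))"
    using assms(1,2)
  proof (induction "card S" arbitrary: S s)
    case 0
    then have "S = {}" by simp
    moreover have "{l. l = c \<and> fst l = None} = {c}"
      using assms(3) by auto
    ultimately show ?case
      using assms(3) by (auto simp: sum_arrangements_rec intro!: sum.neutral)
  next
    case (Suc n)
    then have ne: "S \<noteq> {}" by auto
    let ?V = "\<lambda>S s. \<Sum>ls\<in>arrangements S s. word_mon (map wt ls)"
    have IH: "(\<Sum>ls\<in>arrangements (S - {l}) t. shuffle_words (map wt ls) [wt c]) =
        ?V (insert c S - {l}) t" if "l \<in> S" for l t
    proof -
      have "insert c S - {l} = insert c (S - {l})"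
        using that Suc.prems(2) by auto
      then show ?thesis
        using that Suc by (simp add: Suc.hyps(1))
    qed
    have IH': "(\<Sum>ls\<in>arrangements (S - {l}) t. gen_z (wt l) * shuffle_words (map wt ls) [wt c]) =
        gen_z (wt l) * ?V (insert c S - {l}) t" if "l \<in> S" for l t
      using IH[OF that] by (simp add: sum_distrib_left[symmetric])
    \<comment> \<open>The words with \<open>c\<close> in front are expanded by the first letter that
      follows, so as to match the second summand of \<open>sw\<close> term by term.\<close>
    have V: "gen_z (wt c) * ?V S s =
      (\<Sum>l | l \<in> S \<and> fst l = None. \<Sum>ls\<in>arrangements (S - {l}) s.
        gen_z (wt c) * word_mon (map wt (l # ls))) +
      (\<Sum>l | l \<in> S \<and> fst l = Some s. \<Sum>ls\<in>arrangements (S - {l}) (\<not> s).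
        gen_z (wt c) * word_mon (map wt (l # ls)))"
      unfolding sum_arrangements_rec[OF Suc.prems(1) ne] distrib_left sum_distrib_left ..
    have sw: "shuffle_words (map wt (l # ls)) [wt c] =
        gen_z (wt l) * shuffle_words (map wt ls) [wt c] + gen_z (wt c) * word_mon (map wt (l # ls))"
      for l ls by simp
    have K: "{l. l \<in> insert c S \<and> fst l = None} = insert c {l. l \<in> S \<and> fst l = None}"
      "{l. l \<in> insert c S \<and> fst l = Some s} = {l. l \<in> S \<and> fst l = Some s}"
      using assms(3) by auto
    have "(\<Sum>ls\<in>arrangements S s. shuffle_words (map wt ls) [wt c]) =
      ((\<Sum>l | l \<in> S \<and> fst l = None. gen_z (wt l) * ?V (insert c S - {l}) s) +
       (\<Sum>l | l \<in> S \<and> fst l = Some s. gen_z (wt l) * ?V (insert c S - {l}) (\<not> s))) +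
      gen_z (wt c) * ?V S s"
      unfolding V unfolding sum_arrangements_rec[OF Suc.prems(1) ne] sw sum.distrib
      by (simp add: IH' del: insert_Diff_if list.map)
    also have "\<dots> = ?V (insert c S) s"
      unfolding sum_arrangements_rec[OF finite.insertI[OF Suc.prems(1)] insert_not_empty] K
      using Suc.prems
      by (subst sum.insert)
        (auto simp: gen_z_mult_word_mon[symmetric] sum_distrib_left[symmetric] algebra_simps
           simp del: insert_Diff_if)
    finally show ?case .
  qed
  moreover have "word_mon ws \<squnion>\<squnion> gen_z k = shuffle_words ws [k]" for ws k
    by (simp add: gen_z_def shuffle_word_mon)
  ultimately show ?thesis
    by (simp add: shuffle_sum_left)
qed

lemma sum_permutations_of_set_rec:
  fixes g :: "'b list \<Rightarrow> 'a :: comm_monoid_add"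
  assumes "finite S" "S \<noteq> {}"
  shows "(\<Sum>xs\<in>permutations_of_set S. g xs) =
    (\<Sum>x\<in>S. \<Sum>xs\<in>permutations_of_set (S - {x}). g (x # xs))"
  unfolding permutations_of_set_nonempty[OF assms(2)] using assms(1)
  by (subst sum.UNION_disjoint) (auto intro!: sum.cong simp: sum.reindex)

text \<open>Without neutral letters an arrangement is a sequence of blocks a_i b_j, that is, a pair
  of independent orderings of \<open>I\<close> and \<open>J\<close>. Each induction step removes one
  block.\<close>

lemma sum_arrangements_pairs:
  assumes "finite I" "finite J" "card I = card J"
  shows "(\<Sum>ls\<in>arrangements (Pair (Some True) ` I \<union> Pair (Some False) ` J) True.
      word_mon (map wt ls)) =
    (\<Sum>xs\<in>permutations_of_set I. \<Sum>ys\<in>permutations_of_set J.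
      prod_list (map (\<lambda>(x, y). gen_z (wt (Some True, x)) * gen_z (wt (Some False, y))) (zip xs ys)))"
  using assms
proof (induction "card I" arbitrary: I J)
  case 0
  then show ?case by (simp add: word_mon_def zero_word_def[symmetric])
next
  case (Suc n)
  let ?L = "\<lambda>I J. Pair (Some True) ` I \<union> Pair (Some False) ` J"
  let ?P = "\<lambda>xs ys. prod_list (map (\<lambda>(x, y). gen_z (wt (Some True, x)) * gen_z (wt (Some False, y)))
    (zip xs ys)) :: H1"
  have ne: "I \<noteq> {}" "J \<noteq> {}" using Suc by auto
  \<comment> \<open>The two halves of a block: in state \<open>True\<close> only an a can come
    first, in state \<open>False\<close> only a b.\<close>
  have step: "(\<Sum>ls\<in>arrangements (?L I' J') True. g ls) =
      (\<Sum>i\<in>I'. \<Sum>ls\<in>arrangements (?L (I' - {i}) J') False. g ((Some True, i) # ls))"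
    "(\<Sum>ls\<in>arrangements (?L I' J') False. g ls) =
      (\<Sum>j\<in>J'. \<Sum>ls\<in>arrangements (?L I' (J' - {j})) True. g ((Some False, j) # ls))"
    if "finite I'" "finite J'" "?L I' J' \<noteq> {}" for I' J' and g :: "label list \<Rightarrow> H1"
  proof -
    have K: "{l. l \<in> ?L I' J' \<and> fst l = None} = {}"
      "{l. l \<in> ?L I' J' \<and> fst l = Some True} = Pair (Some True) ` I'"
      "{l. l \<in> ?L I' J' \<and> fst l = Some False} = Pair (Some False) ` J'"
      by auto
    have D: "?L I' J' - {(Some True, i)} = ?L (I' - {i}) J'"
      "?L I' J' - {(Some False, i)} = ?L I' (J' - {i})" for i
      by auto
    have "finite (?L I' J')"
      using that by simp
    note rec = sum_arrangements_rec[OF this that(3)]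
    show "(\<Sum>ls\<in>arrangements (?L I' J') True. g ls) =
      (\<Sum>i\<in>I'. \<Sum>ls\<in>arrangements (?L (I' - {i}) J') False. g ((Some True, i) # ls))"
      "(\<Sum>ls\<in>arrangements (?L I' J') False. g ls) =
      (\<Sum>j\<in>J'. \<Sum>ls\<in>arrangements (?L I' (J' - {j})) True. g ((Some False, j) # ls))"
      unfolding rec K by (simp_all add: sum.reindex inj_on_def D)
  qed
  have "(\<Sum>ls\<in>arrangements (?L I J) True. word_mon (map wt ls)) =
      (\<Sum>i\<in>I. \<Sum>j\<in>J. \<Sum>ls\<in>arrangements (?L (I - {i}) (J - {j})) True.
        word_mon (map wt ((Some True, i) # (Some False, j) # ls)))"
    using Suc.prems(1,2) ne
    by (subst step(1)) (auto intro!: sum.cong[OF refl] simp: step(2))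
  also have "\<dots> = (\<Sum>i\<in>I. \<Sum>j\<in>J. gen_z (wt (Some True, i)) * gen_z (wt (Some False, j)) *
      (\<Sum>ls\<in>arrangements (?L (I - {i}) (J - {j})) True. word_mon (map wt ls)))"
    by (simp add: gen_z_mult_word_mon[symmetric] sum_distrib_left mult.assoc)
  also have "\<dots> = (\<Sum>i\<in>I. \<Sum>j\<in>J. gen_z (wt (Some True, i)) * gen_z (wt (Some False, j)) *
      (\<Sum>xs\<in>permutations_of_set (I - {i}). \<Sum>ys\<in>permutations_of_set (J - {j}). ?P xs ys))"
    using Suc by (intro sum.cong refl) (simp add: card_Diff_singleton)
  also have "\<dots> = (\<Sum>i\<in>I. \<Sum>xs\<in>permutations_of_set (I - {i}).
      \<Sum>j\<in>J. \<Sum>ys\<in>permutations_of_set (J - {j}). ?P (i # xs) (j # ys))"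
    by (simp add: sum_distrib_left sum.swap[of _ J])
  also have "\<dots> = (\<Sum>xs\<in>permutations_of_set I. \<Sum>ys\<in>permutations_of_set J. ?P xs ys)"
    using Suc.prems(1,2) ne by (simp add: sum_permutations_of_set_rec)
  finally show ?case .
qed

text \<open>A permutation is the identity outside \<open>{..<m}\<close>, so its list of values
  determines it. This turns sums over the symmetric group into sums over orderings.\<close>

lemma bij_betw_permutes_permutations_of_set:
  "bij_betw (\<lambda>\<sigma>. map \<sigma> [0..<m]) {\<sigma>. \<sigma> permutes {..<m}} (permutations_of_set {..<m})"
proof (rule bij_betw_imageI)
  show "inj_on (\<lambda>\<sigma>. map \<sigma> [0..<m]) {\<sigma>. \<sigma> permutes {..<m}}"
  proof (rule inj_onI)
    fix \<sigma> \<tau> :: "nat \<Rightarrow> nat"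
    assume "\<sigma> \<in> {\<sigma>. \<sigma> permutes {..<m}}" "\<tau> \<in> {\<sigma>. \<sigma> permutes {..<m}}"
      "map \<sigma> [0..<m] = map \<tau> [0..<m]"
    then show "\<sigma> = \<tau>"
      by (intro ext) (metis atLeastLessThan_iff lessThan_iff map_eq_conv mem_Collect_eq
        permutes_not_in set_upt zero_le)
  qed
  show "(\<lambda>\<sigma>. map \<sigma> [0..<m]) ` {\<sigma>. \<sigma> permutes {..<m}} = permutations_of_set {..<m}" (is "?f ` _ = _")
  proof (intro equalityI subsetI)
    fix xs assume "xs \<in> ?f ` {\<sigma>. \<sigma> permutes {..<m}}"
    then obtain \<sigma> where "\<sigma> permutes {..<m}" "xs = map \<sigma> [0..<m]" by auto
    then show "xs \<in> permutations_of_set {..<m}"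
      by (intro permutations_of_setI)
        (simp_all add: permutes_image permutes_inj_on distinct_map atLeast0LessThan)
  next
    fix xs assume xs: "xs \<in> permutations_of_set {..<m}"
    then have "mset xs = mset [0..<m]"
      by (metis atLeast0LessThan distinct_upt permutations_of_setD set_eq_iff_mset_eq_distinct set_upt)
    then obtain \<sigma> where "\<sigma> permutes {..<length [0..<m]}" "permute_list \<sigma> [0..<m] = xs"
      by (rule mset_eq_permutation)
    moreover from this have "permute_list \<sigma> [0..<m] = map \<sigma> [0..<m]"
      unfolding permute_list_def
      by (intro map_cong refl) (use permutes_in_image[of \<sigma>] in force)+
    ultimately show "xs \<in> ?f ` {\<sigma>. \<sigma> permutes {..<m}}"
      by auto
  qed
qed

definition labels :: "nat \<Rightarrow> nat \<Rightarrow> label set" where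
  "labels m n = Pair (Some True) ` {..<m} \<union> Pair (Some False) ` {..<m} \<union> Pair None ` {..<n}"

lemma finite_labels [simp]: "finite (labels m n)"
  by (simp add: labels_def)

lemma labels_Suc: "labels m (Suc n) = insert (None, n) (labels m n)"
  by (auto simp: labels_def lessThan_Suc)

lemma None_notin_labels: "(None, n) \<notin> labels m n"
  by (auto simp: labels_def)

fun weight :: "pnat list \<times> pnat list \<times> pnat list \<Rightarrow> label \<Rightarrow> pnat" where
  "weight (a, b, c) (Some True, i) = a ! i"
| "weight (a, b, c) (Some False, i) = b ! i"
| "weight (a, b, c) (None, i) = c ! i"

lemma z_tuple_eq_sum_arrangements:
  assumes "length a = m" "length b = m"
  shows "z_tuple (a, b, c) =
    (\<Sum>ls\<in>arrangements (labels m (length c)) True. word_mon (map (weight (a, b, c)) ls))"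
proof -
  let ?w = "weight (a, b, c)"
  let ?V = "\<lambda>j. \<Sum>ls\<in>arrangements (labels m j) True. word_mon (map ?w ls)"
  let ?g = "\<lambda>x y. gen_z (a ! x) * gen_z (b ! y)"
  let ?P = "\<lambda>xs ys. prod_list (map (\<lambda>(x, y). ?g x y) (zip xs ys)) :: H1"
  have "?V 0 = (\<Sum>xs\<in>permutations_of_set {..<m}. \<Sum>ys\<in>permutations_of_set {..<m}. ?P xs ys)"
    using sum_arrangements_pairs[of "{..<m}" "{..<m}" ?w] by (simp add: labels_def)
  also have "\<dots> = (\<Sum>\<sigma> | \<sigma> permutes {..<m}. \<Sum>\<tau> | \<tau> permutes {..<m}.
      ?P (map \<sigma> [0..<m]) (map \<tau> [0..<m]))"
    by (simp add: sum.reindex_bij_betw[OF bij_betw_permutes_permutations_of_set, symmetric])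
  also have "\<dots> = (\<Sum>\<sigma> | \<sigma> permutes {..<m}. \<Sum>\<tau> | \<tau> permutes {..<m}.
      prod_list (map (\<lambda>i. ?g (\<sigma> i) (\<tau> i)) [0..<m]))"
    by (simp add: zip_map_map zip_same_conv_map o_def)
  finally have base: "\<dots> = ?V 0" ..
  \<comment> \<open>The letters c_j are shuffled in one at a time, each adding the label
    \<open>(None, j)\<close>.\<close>
  have "foldl (\<squnion>\<squnion>) (?V 0) (map gen_z (take j c)) = ?V j" if "j \<le> length c" for j
    using that
  proof (induction j)
    case (Suc j)
    then have "foldl (\<squnion>\<squnion>) (?V 0) (map gen_z (take (Suc j) c)) = ?V j \<squnion>\<squnion> gen_z (?w (None, j))"
      by (simp add: take_Suc_conv_app_nth)
    also have "\<dots> = ?V (Suc j)"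
      unfolding labels_Suc by (rule sum_shuffle_letter) (simp_all add: None_notin_labels)
    finally show ?case .
  qed simp
  from this[of "length c"] show ?thesis
    using assms by (simp add: base)
qed

section \<open>Sums and vanishing in the ring of families modulo primes\<close>

lemma linear_ext_sum: "linear_ext f (\<Sum>i\<in>I. g i) = (\<Sum>i\<in>I. linear_ext f (g i))"
  by (induction I rule: infinite_finite_induct) (simp_all add: linear_ext_add, simp_all add: linear_ext_def)

lemma sum_family_A: "(\<Sum>i\<in>I. family_A (f i)) = family_A (\<lambda>p. \<Sum>i\<in>I. f i p)"
  by (induction I rule: infinite_finite_induct)
    (simp_all add: zero_A_ring.abs_eq plus_A_ring.abs_eq)

text \<open>Finitely many exceptional primes are invisible in the quotient, so vanishing for large
  primes suffices.\<close>

lemma family_A_eq_0I: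
  assumes "\<And>p. prime p \<Longrightarrow> p > N \<Longrightarrow> [f p = 0] (mod int p)"
  shows "family_A f = 0"
proof -
  have "{p. prime p \<and> \<not> [f p = 0] (mod int p)} \<subseteq> {..N}"
    using assms not_less by blast
  then show ?thesis
    unfolding zero_A_ring.abs_eq A_ring.abs_eq_iff A_rel_def by (rule finite_subset) simp
qed

subsection \<open>Truncated harmonic sums\<close>

text \<open>\<open>zsum v n\<close> sums over \<open>n \<ge> m\<^sub>1 > m\<^sub>2 > \<dots> \<ge> 1\<close> and \<open>zstar v n\<close> over \<open>n \<ge> m\<^sub>1 \<ge> m\<^sub>2 \<ge> \<dots> \<ge> 1\<close>.\<close>

fun zsum :: "(nat \<Rightarrow> 'l \<Rightarrow> int) \<Rightarrow> nat \<Rightarrow> 'l list \<Rightarrow> int" where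
  "zsum v n [] = 1"
| "zsum v 0 (l # ls) = 0"
| "zsum v (Suc n) (l # ls) = zsum v n (l # ls) + v (Suc n) l * zsum v n ls"

fun zstar :: "(nat \<Rightarrow> 'l \<Rightarrow> int) \<Rightarrow> nat \<Rightarrow> 'l list \<Rightarrow> int" where
  "zstar v n [] = 1"
| "zstar v 0 (l # ls) = 0"
| "zstar v (Suc n) (l # ls) = zstar v n (l # ls) + v (Suc n) l * zstar v (Suc n) ls"

text \<open>Used for the powers of 2 that arise from doubling.\<close>

lemma zsum_scale: "zsum (\<lambda>m l. r l * v m l) n ls = prod_list (map r ls) * zsum v n ls"
  by (induction "\<lambda>m l. r l * v m l" n ls rule: zsum.induct) (simp_all add: algebra_simps)

definition tuples :: "(nat \<Rightarrow> nat \<Rightarrow> bool) \<Rightarrow> nat \<Rightarrow> nat \<Rightarrow> nat list set" where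
  "tuples R n k = {ms. length ms = k \<and> sorted_wrt R ms \<and> set ms \<subseteq> {1..n}}"

lemma finite_tuples [simp]: "finite (tuples R n k)"
  by (rule finite_subset[OF _ finite_lists_length_eq[of "{1..n}" k]]) (auto simp: tuples_def)

lemma tuples_0 [simp]: "tuples R n 0 = {[]}"
  by (auto simp: tuples_def)

lemma tuples_bound_0 [simp]: "tuples R 0 (Suc k) = {}"
  by (auto simp: tuples_def)

lemma Cons_in_tuples:
  "x # xs \<in> tuples R n (Suc k) \<longleftrightarrow> x \<in> {1..n} \<and> (\<forall>y\<in>set xs. R x y) \<and> xs \<in> tuples R n k"
  by (auto simp: tuples_def)

lemma tuples_Suc_iff: "xs \<in> tuples R n k \<longleftrightarrow> xs \<in> tuples R (Suc n) k \<and> (\<forall>y\<in>set xs. y \<le> n)"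
  unfolding tuples_def subset_iff by auto

text \<open>The head is the largest entry; if it is \<open>Suc n\<close>, strictness bounds the tail
  by \<open>n\<close>. This matches the last equation of \<open>zsum\<close>.\<close>

lemma tuples_greater_Suc:
  "tuples (>) (Suc n) (Suc k) = tuples (>) n (Suc k) \<union> (#) (Suc n) ` tuples (>) n k"
proof (rule set_eqI)
  fix ms
  show "ms \<in> tuples (>) (Suc n) (Suc k) \<longleftrightarrow>
      ms \<in> tuples (>) n (Suc k) \<union> (#) (Suc n) ` tuples (>) n k"
  proof (cases ms)
    case (Cons x xs)
    show ?thesis
      unfolding Cons Un_iff image_iff Cons_in_tuples
      using tuples_Suc_iff[of xs "(>)" n k] by (auto simp: less_Suc_eq_le le_Suc_eq)
  qed (auto simp: tuples_def)
qed

text \<open>Now the tail may begin with \<open>Suc n\<close> again, so its bound stays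
  \<open>Suc n\<close>, as in the last equation of \<open>zstar\<close>.\<close>

lemma tuples_greater_eq_Suc:
  "tuples (\<ge>) (Suc n) (Suc k) = tuples (\<ge>) n (Suc k) \<union> (#) (Suc n) ` tuples (\<ge>) (Suc n) k"
proof (rule set_eqI)
  fix ms
  show "ms \<in> tuples (\<ge>) (Suc n) (Suc k) \<longleftrightarrow>
      ms \<in> tuples (\<ge>) n (Suc k) \<union> (#) (Suc n) ` tuples (\<ge>) (Suc n) k"
  proof (cases ms)
    case (Cons x xs)
    have bound: "\<forall>y\<in>set xs. y \<le> Suc n" if "xs \<in> tuples (\<ge>) (Suc n) k"
      using that by (auto simp: tuples_def)
    show ?thesis
      unfolding Cons Un_iff image_iff Cons_in_tuples
      using bound tuples_Suc_iff[of xs "(\<ge>)" n k] by (auto simp: le_Suc_eq)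
  qed (auto simp: tuples_def)
qed
lemma harm_term_Nil [simp]: "harm_term p [] ms = 1"
  by (simp add: harm_term_def)

lemma harm_term_Cons:
  "harm_term p (k # ks) (m # ms) =
    modular_inverse (int p) (int m) ^ nat_of_pnat k * harm_term p ks ms"
  by (simp add: harm_term_def prod.lessThan_Suc_shift del: prod.lessThan_Suc)

lemma zsum_eq:
  "zsum (\<lambda>m k. modular_inverse (int p) (int m) ^ nat_of_pnat k) n ks =
    (\<Sum>ms\<in>tuples (>) n (length ks). harm_term p ks ms)"
proof (induction "\<lambda>m k. modular_inverse (int p) (int m) ^ nat_of_pnat k" n ks rule: zsum.induct)
  case (3 n k ks)
  have "tuples (>) n (Suc (length ks)) \<inter> (#) (Suc n) ` tuples (>) n (length ks) = {}"
    by (auto simp: tuples_def)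
  with 3 show ?case
    by (simp add: tuples_greater_Suc sum.union_disjoint sum.reindex harm_term_Cons sum_distrib_left)
qed simp_all

lemma zstar_eq:
  "zstar (\<lambda>m k. modular_inverse (int p) (int m) ^ nat_of_pnat k) n ks =
    (\<Sum>ms\<in>tuples (\<ge>) n (length ks). harm_term p ks ms)"
proof (induction "\<lambda>m k. modular_inverse (int p) (int m) ^ nat_of_pnat k" n ks rule: zstar.induct)
  case (3 n k ks)
  have "tuples (\<ge>) n (Suc (length ks)) \<inter> (#) (Suc n) ` tuples (\<ge>) (Suc n) (length ks) = {}"
    by (auto simp: tuples_def)
  with 3 show ?case
    by (simp add: tuples_greater_eq_Suc sum.union_disjoint sum.reindex harm_term_Cons sum_distrib_left)
qed simp_all

lemma zsum_map: "zsum v n (map w ls) = zsum (\<lambda>m l. v m (w l)) n ls"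
  by (induction "\<lambda>m l. v m (w l)" n ls rule: zsum.induct) simp_all

lemma zstar_map: "zstar v n (map w ls) = zstar (\<lambda>m l. v m (w l)) n ls"
  by (induction "\<lambda>m l. v m (w l)" n ls rule: zstar.induct) simp_all

lemma family_A_cong_prime:
  assumes "\<And>p. prime p \<Longrightarrow> f p = g p"
  shows "family_A f = family_A g"
proof -
  have no_primes: "{p. prime p \<and> [f p \<noteq> g p] (mod int p)} = {}"
    using assms by auto
  show ?thesis
    unfolding A_ring.abs_eq_iff A_rel_def no_primes by simp
qed

lemma zeta_A_map:
  "zeta_A (map w ls) =
    family_A (\<lambda>p. zsum (\<lambda>m l. modular_inverse (int p) (int m) ^ nat_of_pnat (w l)) (p - 1) ls)"
  unfolding zeta_A_def
    zsum_map[where w = w and v = "\<lambda>m k. modular_inverse _ (int m) ^ nat_of_pnat k", symmetric] zsum_eq tuples_def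
  by (rule family_A_cong_prime)
    (simp add: atLeastLessThanSuc_atLeastAtMost[symmetric] prime_gt_0_nat)

lemma zeta_star_A_map:
  "zeta_star_A (map w ls) =
    family_A (\<lambda>p. zstar (\<lambda>m l. modular_inverse (int p) (int m) ^ nat_of_pnat (w l)) (p - 1) ls)"
  unfolding zeta_star_A_def
    zstar_map[where w = w and v = "\<lambda>m k. modular_inverse _ (int m) ^ nat_of_pnat k", symmetric] zstar_eq tuples_def
  by (rule family_A_cong_prime)
    (simp add: atLeastLessThanSuc_atLeastAtMost[symmetric] prime_gt_0_nat)

subsection \<open>Congruence of multilinear coefficients\<close>

text \<open>Multisets of labels encode monomials in commuting variables, and inclusion of multisets
  is divisibility.\<close>

lemma lookup_single_mult:
  fixes F :: "'l multiset \<Rightarrow>\<^sub>0 int"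
  shows "Poly_Mapping.lookup (Poly_Mapping.single N c * F) M =
    (if N \<subseteq># M then c * Poly_Mapping.lookup F (M - N) else 0)"
proof -
  have F: "F = (\<Sum>K\<in>Poly_Mapping.keys F. Poly_Mapping.single K (Poly_Mapping.lookup F K))"
    by (rule poly_mapping_eqI) (simp add: lookup_sum lookup_single when_def in_keys_iff)
  have "Poly_Mapping.single N c * F =
      (\<Sum>K\<in>Poly_Mapping.keys F. Poly_Mapping.single (N + K) (c * Poly_Mapping.lookup F K))"
    by (subst F) (simp add: sum_distrib_left mult_single)
  then have "Poly_Mapping.lookup (Poly_Mapping.single N c * F) M =
      (\<Sum>K\<in>Poly_Mapping.keys F. if N + K = M then c * Poly_Mapping.lookup F K else 0)"
    by (simp add: lookup_sum lookup_single when_def)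
  also have "\<dots> = (if N \<subseteq># M then c * Poly_Mapping.lookup F (M - N) else 0)"
  proof (cases "N \<subseteq># M")
    case True
    then have "N + K = M \<longleftrightarrow> K = M - N" for K
      by (metis add_diff_cancel_left' subset_mset.add_diff_inverse)
    with True show ?thesis
      by (simp add: in_keys_iff)
  next
    case False
    then have "N + K \<noteq> M" for K by auto
    with False show ?thesis by simp
  qed
  finally show ?thesis .
qed

text \<open>Equality of polynomials modulo \<open>p\<close> and modulo the ideal spanned by the
  monomials not dividing \<open>B\<close>. For \<open>B = mset_set L\<close> only the multilinear
  coefficients remain.\<close>

definition coeffs_cong :: "int \<Rightarrow> 'l multiset \<Rightarrow> ('l multiset \<Rightarrow>\<^sub>0 int) \<Rightarrow> ('l multiset \<Rightarrow>\<^sub>0 int) \<Rightarrow> bool"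
  where "coeffs_cong p B F G \<longleftrightarrow>
    (\<forall>M. M \<subseteq># B \<longrightarrow> [Poly_Mapping.lookup F M = Poly_Mapping.lookup G M] (mod p))"

lemma coeffs_cong_refl [simp]: "coeffs_cong p B F F"
  by (simp add: coeffs_cong_def)

lemma coeffs_cong_sym: "coeffs_cong p B F G \<Longrightarrow> coeffs_cong p B G F"
  by (simp add: coeffs_cong_def cong_sym_eq)

lemma coeffs_cong_trans [trans]:
  "coeffs_cong p B F G \<Longrightarrow> coeffs_cong p B G H \<Longrightarrow> coeffs_cong p B F H"
  unfolding coeffs_cong_def by (metis cong_trans)

lemma coeffs_cong_add:
  "coeffs_cong p B F G \<Longrightarrow> coeffs_cong p B F' G' \<Longrightarrow> coeffs_cong p B (F + F') (G + G')"
  by (simp add: coeffs_cong_def lookup_add cong_add)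

lemma coeffs_cong_diff:
  "coeffs_cong p B F G \<Longrightarrow> coeffs_cong p B F' G' \<Longrightarrow> coeffs_cong p B (F - F') (G - G')"
  by (simp add: coeffs_cong_def lookup_minus cong_diff)

lemma coeffs_cong_sum:
  assumes "\<And>i. i \<in> I \<Longrightarrow> coeffs_cong p B (f i) (g i)"
  shows "coeffs_cong p B (\<Sum>i\<in>I. f i) (\<Sum>i\<in>I. g i)"
  using assms by (simp add: coeffs_cong_def lookup_sum cong_sum)

text \<open>The coefficient of a product at a divisor of \<open>B\<close> involves the factors only
  at divisors of that monomial, which divide \<open>B\<close> again.\<close>

lemma coeffs_cong_mult_left:
  assumes "coeffs_cong p B F G"
  shows "coeffs_cong p B (H * F) (H * G)"
proof -
  have H: "H = (\<Sum>K\<in>Poly_Mapping.keys H. Poly_Mapping.single K (Poly_Mapping.lookup H K))"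
    by (rule poly_mapping_eqI) (simp add: lookup_sum lookup_single when_def in_keys_iff)
  have "coeffs_cong p B (Poly_Mapping.single K c * F) (Poly_Mapping.single K c * G)" for K c
  proof -
    have "M - K \<subseteq># B" if "M \<subseteq># B" for M
      by (rule subset_mset.order_trans[OF diff_subset_eq_self that])
    then show ?thesis
      using assms unfolding coeffs_cong_def lookup_single_mult by (simp add: cong_scalar_left)
  qed
  then show ?thesis
    by (subst (1 2) H) (simp only: sum_distrib_right coeffs_cong_sum)
qed

lemma coeffs_cong_mult:
  assumes "coeffs_cong p B F G" "coeffs_cong p B F' G'"
  shows "coeffs_cong p B (F * F') (G * G')"
proof -
  have "coeffs_cong p B (F * F') (F * G')"
    by (rule coeffs_cong_mult_left[OF assms(2)])
  also have "coeffs_cong p B (F * G') (G * G')"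
    using coeffs_cong_mult_left[OF assms(1), of G'] by (simp only: mult.commute[of _ G'])
  finally show ?thesis .
qed

lemma coeffs_cong_prod:
  assumes "\<And>i. i \<in> I \<Longrightarrow> coeffs_cong p B (f i) (g i)"
  shows "coeffs_cong p B (\<Prod>i\<in>I. f i) (\<Prod>i\<in>I. g i)"
  using assms by (induction I rule: infinite_finite_induct) (simp_all add: coeffs_cong_mult)

subsection \<open>The transfer matrices\<close>

text \<open>The forms C, X, Y for \<open>None\<close>, \<open>Some True\<close>,
  \<open>Some False\<close>, at a single m.\<close>

definition lin :: "label set \<Rightarrow> (label \<Rightarrow> int) \<Rightarrow> bool option \<Rightarrow> label multiset \<Rightarrow>\<^sub>0 int" where
  "lin L v \<kappa> = (\<Sum>l | l \<in> L \<and> fst l = \<kappa>. Poly_Mapping.single {#l#} (v l))"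

text \<open>A matrix M(m) is encoded by its action on column vectors indexed by the state, so that a
  \<open>foldr\<close> of actions is a matrix product.\<close>

definition act :: "label set \<Rightarrow> (label \<Rightarrow> int) \<Rightarrow> (bool \<Rightarrow> label multiset \<Rightarrow>\<^sub>0 int) \<Rightarrow>
    bool \<Rightarrow> label multiset \<Rightarrow>\<^sub>0 int" where
  "act L v u s = (1 + lin L v None) * u s + lin L v (Some s) * u (\<not> s)"

definition detm :: "label set \<Rightarrow> (label \<Rightarrow> int) \<Rightarrow> label multiset \<Rightarrow>\<^sub>0 int" where
  "detm L v = (1 + lin L v None) * (1 + lin L v None) - lin L v (Some True) * lin L v (Some False)"

text \<open>The entries mirror \<open>alternating s []\<close>: the empty list is accepted in state
  \<open>True\<close> only.\<close>

definition unit_vec :: "bool \<Rightarrow> label multiset \<Rightarrow>\<^sub>0 int" where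
  "unit_vec s = (if s then 1 else 0)"

lemma lookup_lin_mult:
  assumes "finite L" "S \<subseteq> L"
  shows "Poly_Mapping.lookup (lin L v \<kappa> * F) (mset_set S) =
    (\<Sum>l | l \<in> S \<and> fst l = \<kappa>. v l * Poly_Mapping.lookup F (mset_set (S - {l})))"
proof -
  have fin: "finite S"
    using assms finite_subset by blast
  have "Poly_Mapping.lookup (lin L v \<kappa> * F) (mset_set S) =
      (\<Sum>l | l \<in> L \<and> fst l = \<kappa>. if l \<in> S then v l * Poly_Mapping.lookup F (mset_set (S - {l})) else 0)"
    unfolding lin_def sum_distrib_right lookup_sum lookup_single_mult
    using fin by (intro sum.cong refl) (auto simp: mset_set_Diff)
  also have "\<dots> = (\<Sum>l | l \<in> S \<and> fst l = \<kappa>. v l * Poly_Mapping.lookup F (mset_set (S - {l})))"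
    using assms by (intro sum.mono_neutral_cong_right) auto
  finally show ?thesis .
qed

lemma lookup_act:
  assumes "finite L" "S \<subseteq> L"
  shows "Poly_Mapping.lookup (act L v u s) (mset_set S) = Poly_Mapping.lookup (u s) (mset_set S) +
    (\<Sum>l | l \<in> S \<and> fst l = None. v l * Poly_Mapping.lookup (u s) (mset_set (S - {l}))) +
    (\<Sum>l | l \<in> S \<and> fst l = Some s. v l * Poly_Mapping.lookup (u (\<not> s)) (mset_set (S - {l})))"
  by (simp add: act_def distrib_right lookup_add lookup_lin_mult[OF assms])

lemma lookup_unit_vec:
  "finite S \<Longrightarrow> Poly_Mapping.lookup (unit_vec s) (mset_set S) = (if s \<and> S = {} then 1 else 0)"
  by (simp add: unit_vec_def lookup_one mset_set_empty_iff when_def)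

lemma submultiset_mset_setE:
  assumes "M \<subseteq># mset_set L" "finite L"
  obtains S where "S \<subseteq> L" "M = mset_set S"
proof
  show "set_mset M \<subseteq> L"
    using assms set_mset_mono by fastforce
  have "count M x \<le> 1" for x
    using assms mset_subset_eq_count[OF assms(1), of x] by (cases "x \<in> L") auto
  then show "M = mset_set (set_mset M)"
    by (intro multiset_eqI) (metis count_eq_zero_iff count_mset_set(1,3) finite_set_mset le_antisym
      less_one linorder_not_less not_in_iff)
qed

lemma coeffs_cong_mset_setI:
  assumes "finite L"
    and "\<And>S. S \<subseteq> L \<Longrightarrow>
      [Poly_Mapping.lookup F (mset_set S) = Poly_Mapping.lookup G (mset_set S)] (mod p)"
  shows "coeffs_cong p (mset_set L) F G"
  unfolding coeffs_cong_def using assms by (auto elim!: submultiset_mset_setE)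

lemma coeffs_cong_mset_setD:
  assumes "finite L" "coeffs_cong p (mset_set L) F G" "S \<subseteq> L"
  shows "[Poly_Mapping.lookup F (mset_set S) = Poly_Mapping.lookup G (mset_set S)] (mod p)"
  using assms unfolding coeffs_cong_def by (simp add: subset_imp_msubset_mset_set)

text \<open>The outermost factor, with index n, contributes either 1 or a first letter evaluated at
  n. This is the recursion of \<open>zsum\<close> combined with that of the arrangements.\<close>

lemma lookup_foldr_act:
  assumes "finite L" "S \<subseteq> L"
  shows "Poly_Mapping.lookup (foldr (\<lambda>m. act L (v m)) (rev [1..<Suc n]) unit_vec s) (mset_set S) =
    (\<Sum>ls\<in>arrangements S s. zsum v n ls)"
proof -
  define W where "W n = foldr (\<lambda>m. act L (v m)) (rev [1..<Suc n]) unit_vec" for n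
  have W: "W 0 = unit_vec" "W (Suc n) = act L (v (Suc n)) (W n)" for n
    by (simp_all add: W_def)
  have "Poly_Mapping.lookup (W n s) (mset_set S) = (\<Sum>ls\<in>arrangements S s. zsum v n ls)"
    using assms(2)
  proof (induction n arbitrary: S s)
    case 0
    then have fin: "finite S"
      using assms(1) finite_subset by blast
    have "zsum v 0 ls = (if ls = [] then 1 else 0)" for ls
      by (cases ls) auto
    moreover have "[] \<in> arrangements S s \<longleftrightarrow> s \<and> S = {}"
      by (auto simp: arrangements_def permutations_of_set_def)
    ultimately show ?case
      using fin by (simp add: lookup_unit_vec W)
  next
    case (Suc n)
    then have fin: "finite S"
      using assms(1) finite_subset by blast
    have IH: "Poly_Mapping.lookup (W n t) (mset_set (S - {l})) =
        (\<Sum>ls\<in>arrangements (S - {l}) t. zsum v n ls)" for l t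
      using Suc by blast
    have "Poly_Mapping.lookup (W (Suc n) s) (mset_set S) = (\<Sum>ls\<in>arrangements S s. zsum v n ls) +
      (\<Sum>l | l \<in> S \<and> fst l = None. v (Suc n) l * (\<Sum>ls\<in>arrangements (S - {l}) s. zsum v n ls)) +
      (\<Sum>l | l \<in> S \<and> fst l = Some s. v (Suc n) l * (\<Sum>ls\<in>arrangements (S - {l}) (\<not> s). zsum v n ls))"
      unfolding W lookup_act[OF assms(1) Suc.prems] IH Suc.IH[OF Suc.prems] ..
    also have "\<dots> = (\<Sum>ls\<in>arrangements S s. zsum v (Suc n) ls)"
    proof (cases "S = {}")
      case False
      show ?thesis
        unfolding sum_arrangements_rec[OF fin False]
        by (simp add: sum.distrib sum_distrib_left)
    qed simp
    finally show ?case .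
  qed
  then show ?thesis
    by (simp add: W_def)
qed

lemma act_scale: "act L v (\<lambda>s. q * u s) = (\<lambda>s. q * act L v u s)"
  by (rule ext) (simp add: act_def algebra_simps)

lemma foldr_act_scale:
  "foldr (\<lambda>m. act L (v m)) ms (\<lambda>s. q * u s) = (\<lambda>s. q * foldr (\<lambda>m. act L (v m)) ms u s)"
  by (induction ms) (simp_all add: act_scale)

lemma coeffs_cong_act:
  assumes "\<And>s. coeffs_cong p B (u s) (u' s)"
  shows "coeffs_cong p B (act L v u s) (act L v u' s)"
  unfolding act_def by (intro coeffs_cong_add coeffs_cong_mult assms coeffs_cong_refl)

lemma coeffs_cong_foldr_act:
  assumes "\<And>s. coeffs_cong p B (u s) (u' s)"
  shows "coeffs_cong p B (foldr (\<lambda>m. act L (v m)) ms u s) (foldr (\<lambda>m. act L (v m)) ms u' s)"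
  by (induction ms arbitrary: s) (simp_all add: assms coeffs_cong_act)

lemma coeffs_cong_lin:
  assumes "\<And>l. l \<in> L \<Longrightarrow> fst l = \<kappa> \<Longrightarrow> [v l = v' l] (mod p)"
  shows "coeffs_cong p B (lin L v \<kappa>) (lin L v' \<kappa>)"
  unfolding lin_def
  by (intro coeffs_cong_sum) (use assms in \<open>auto simp: coeffs_cong_def lookup_single when_def\<close>)

lemma lin_uminus: "lin L (\<lambda>l. - v l) \<kappa> = - lin L v \<kappa>"
  by (simp add: lin_def sum_negf single_uminus)

text \<open>The effect of negating the argument of the powers: the even ones, labelled
  \<open>None\<close>, stay, and the odd ones change sign.\<close>

definition cong_up_to_parity :: "int \<Rightarrow> label set \<Rightarrow> (label \<Rightarrow> int) \<Rightarrow> (label \<Rightarrow> int) \<Rightarrow> bool" where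
  "cong_up_to_parity p L v' v \<longleftrightarrow>
    (\<forall>l\<in>L. [v' l = (if fst l = None then v l else - v l)] (mod p))"

lemma coeffs_cong_lin_parity:
  assumes "cong_up_to_parity p L v' v"
  shows "coeffs_cong p B (lin L v' None) (lin L v None)"
    and "coeffs_cong p B (lin L v' (Some t)) (- lin L v (Some t))"
  using assms unfolding cong_up_to_parity_def lin_uminus[symmetric]
  by (force intro!: coeffs_cong_lin)+

lemma coeffs_cong_detm:
  assumes "\<And>l. l \<in> L \<Longrightarrow> [v' l = v l] (mod p)"
  shows "coeffs_cong p B (detm L v') (detm L v)"
  unfolding detm_def
  by (intro coeffs_cong_diff coeffs_cong_add coeffs_cong_mult coeffs_cong_refl coeffs_cong_lin assms)

text \<open>Both off-diagonal forms change sign, and only their product enters the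
  determinant.\<close>

lemma coeffs_cong_detm_parity:
  assumes "cong_up_to_parity p L v' v"
  shows "coeffs_cong p B (detm L v') (detm L v)"
proof -
  have "coeffs_cong p B (detm L v') ((1 + lin L v None) * (1 + lin L v None) -
      (- lin L v (Some True)) * (- lin L v (Some False)))"
    unfolding detm_def
    by (intro coeffs_cong_diff coeffs_cong_add coeffs_cong_mult coeffs_cong_refl
        coeffs_cong_lin_parity[OF assms])
  then show ?thesis
    by (simp add: detm_def)
qed

text \<open>The sign change turns the matrix into its adjugate, and the adjugate times the matrix is
  the determinant.\<close>

lemma act_act_parity:
  assumes "cong_up_to_parity p L v' v"
  shows "coeffs_cong p B (act L v' (act L v u) s) (detm L v * u s)"
proof -
  have "coeffs_cong p B (act L v' (act L v u) s)
      ((1 + lin L v None) * act L v u s + (- lin L v (Some s)) * act L v u (\<not> s))"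
    unfolding act_def[of L v']
    by (intro coeffs_cong_add coeffs_cong_mult coeffs_cong_refl coeffs_cong_lin_parity[OF assms])
  also have "\<dots> = detm L v * u s"
    by (cases s) (simp_all add: act_def detm_def algebra_simps)
  finally show ?thesis .
qed

text \<open>The product telescopes from the middle outwards, since a scalar commutes with everything.\<close>

lemma foldr_act_parity:
  assumes "\<And>m. m \<in> set ms \<Longrightarrow> cong_up_to_parity p L (v (\<nu> m)) (v m)"
  shows "coeffs_cong p B (foldr (\<lambda>m. act L (v m)) (rev (map \<nu> ms) @ ms) u s)
    ((\<Prod>m\<leftarrow>ms. detm L (v m)) * u s)"
  using assms
proof (induction ms arbitrary: s)
  case (Cons m ms)
  let ?F = "foldr (\<lambda>m. act L (v m))"
  have "coeffs_cong p B (?F (rev (map \<nu> ms)) (act L (v (\<nu> m)) (act L (v m) (?F ms u))) s)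
      (?F (rev (map \<nu> ms)) (\<lambda>s. detm L (v m) * ?F ms u s) s)"
    by (intro coeffs_cong_foldr_act act_act_parity) (simp add: Cons.prems)
  also have "\<dots> = detm L (v m) * ?F (rev (map \<nu> ms) @ ms) u s"
    by (simp add: foldr_act_scale)
  also have "coeffs_cong p B \<dots> (detm L (v m) * ((\<Prod>m\<leftarrow>ms. detm L (v m)) * u s))"
    using Cons by (intro coeffs_cong_mult_left) simp
  finally show ?case by (simp add: mult.assoc)
qed simp

subsection \<open>Vanishing modulo large primes\<close>

lemma modular_inverse_cong:
  fixes m p x :: int
  assumes "[m * x = 1] (mod p)"
  shows "[modular_inverse p m = x] (mod p)"
proof -
  have cop: "coprime m p"
    using assms by (metis coprime_iff_invertible_int)
  have "[modular_inverse p m * (m * x) = modular_inverse p m * 1] (mod p)"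
    by (rule cong_scalar_left[OF assms])
  moreover have "[modular_inverse p m * m * x = 1 * x] (mod p)"
    by (rule cong_scalar_right[OF cong_modular_inverse2[OF cop]])
  ultimately show ?thesis
    by (simp add: mult.assoc) (metis cong_sym cong_trans)
qed

text \<open>The reflection exchanges the two halves of 1, ..., p - 1 and reverses the order, which
  places partners symmetrically around the middle.\<close>

lemma upt_reflect:
  assumes "p = Suc (2 * h)"
  shows "map (\<lambda>m. p - m) (rev [1..<Suc h]) = [Suc h..<p]"
    and "map (\<lambda>m. p - m) [Suc h..<p] = rev [1..<Suc h]"
    and "[1..<p] = [1..<Suc h] @ [Suc h..<p]"
proof -
  show "[1..<p] = [1..<Suc h] @ [Suc h..<p]"
    using upt_add_eq_append[of 1 "Suc h" h] assms by (simp add: mult_2 del: upt_Suc)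
qed (rule nth_equalityI; use assms in \<open>simp add: rev_nth del: upt_Suc\<close>)+

section \<open>Reflection and doubling modulo a fixed large prime\<close>

context
  fixes p h :: nat and L :: "label set" and w :: "label \<Rightarrow> pnat"
  assumes prime_p: "prime p" and p_eq: "p = Suc (2 * h)"
    and finite_L: "finite L"
    and parity: "\<And>l. l \<in> L \<Longrightarrow> even (nat_of_pnat (w l)) \<longleftrightarrow> fst l = None"
    and p_large: "2 ^ (\<Sum>l\<in>L. nat_of_pnat (w l)) < p"
begin

text \<open>The sign \<open>\<epsilon>\<close> is 1 for the harmonic terms themselves and -1 for the
  negated matrices of the starred case.\<close>

definition term_val :: "int \<Rightarrow> nat \<Rightarrow> label \<Rightarrow> int" where
  "term_val \<epsilon> m l = \<epsilon> * modular_inverse (int p) (int m) ^ nat_of_pnat (w l)"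

text \<open>For weight k this is \<open>\<epsilon>\<close> times (m/2)^(-k), so its value at 2m
  agrees modulo p with \<open>term_val\<close> at m when 2m < p.\<close>

definition double_val :: "int \<Rightarrow> nat \<Rightarrow> label \<Rightarrow> int" where
  "double_val \<epsilon> m l = 2 ^ nat_of_pnat (w l) * term_val \<epsilon> m l"

lemma inverse_cong:
  assumes "m \<in> {1..<p}"
  shows "[int m * modular_inverse (int p) (int m) = 1] (mod int p)"
proof -
  have "coprime p m"
    using assms prime_p by (intro prime_imp_coprime) (auto dest: dvd_imp_le)
  then show ?thesis
    by (intro cong_modular_inverse1) (simp add: coprime_commute)
qed

text \<open>This holds since -a m is congruent to p - a m. The case a = 1 is the reflection; a = 2
  serves the doubling when 2m > h.\<close>

lemma reflect_cong:
  assumes "m \<in> {1..<p}" "0 < a" "a * m < p"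
  shows "[modular_inverse (int p) (int m) = - int a * modular_inverse (int p) (int (p - a * m))] (mod int p)"
proof (rule modular_inverse_cong)
  have "p - a * m \<in> {1..<p}"
    using assms by auto
  then have "[int (p - a * m) * modular_inverse (int p) (int (p - a * m)) = 1] (mod int p)"
    by (rule inverse_cong)
  moreover have "[int m * (- int a * x) = int (p - a * m) * x] (mod int p)" for x
  proof -
    have "int m * (- int a * x) - int (p - a * m) * x = int p * - x"
      using assms(3) by (simp add: of_nat_diff algebra_simps)
    then show ?thesis
      unfolding cong_iff_dvd_diff by (simp only: dvd_triv_left)
  qed
  ultimately show "[int m * (- int a * modular_inverse (int p) (int (p - a * m))) = 1] (mod int p)"
    using cong_trans by blast
qed

lemma double_cong:
  assumes "m \<in> {1..<p}" "2 * m < p"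
  shows "[modular_inverse (int p) (int m) = 2 * modular_inverse (int p) (int (2 * m))] (mod int p)"
proof (rule modular_inverse_cong)
  have "2 * m \<in> {1..<p}"
    using assms by auto
  from inverse_cong[OF this]
  show "[int m * (2 * modular_inverse (int p) (int (2 * m))) = 1] (mod int p)"
    by (simp add: mult_ac)
qed

lemma cong_up_to_parity_power:
  assumes "[x = - y] (mod int p)"
  shows "cong_up_to_parity (int p) L (\<lambda>l. \<epsilon> * x ^ nat_of_pnat (w l)) (\<lambda>l. \<epsilon> * y ^ nat_of_pnat (w l))"
  unfolding cong_up_to_parity_def
proof
  fix l assume "l \<in> L"
  have "[\<epsilon> * x ^ nat_of_pnat (w l) = \<epsilon> * (- y) ^ nat_of_pnat (w l)] (mod int p)"
    by (intro cong_mult cong_refl cong_pow assms)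
  also have "(- y) ^ nat_of_pnat (w l) =
      (if fst l = None then y ^ nat_of_pnat (w l) else - (y ^ nat_of_pnat (w l)))"
    using parity[OF \<open>l \<in> L\<close>] by (auto simp: power_minus_odd)
  finally show "[\<epsilon> * x ^ nat_of_pnat (w l) =
      (if fst l = None then \<epsilon> * y ^ nat_of_pnat (w l) else - (\<epsilon> * y ^ nat_of_pnat (w l)))] (mod int p)"
    by (cases "fst l") simp_all
qed

lemma term_val_parity:
  assumes "m \<in> {1..<p}"
  shows "cong_up_to_parity (int p) L (term_val \<epsilon> (p - m)) (term_val \<epsilon> m)"
  unfolding term_val_def
proof (rule cong_up_to_parity_power)
  have "p - m \<in> {1..<p}" "p - (p - m) = m"
    using assms by auto
  then show "[modular_inverse (int p) (int (p - m)) = - modular_inverse (int p) (int m)] (mod int p)"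
    using reflect_cong[of "p - m" 1] assms by simp
qed

lemma double_val_parity:
  assumes "m \<in> {1..<p}"
  shows "cong_up_to_parity (int p) L (double_val \<epsilon> (p - m)) (double_val \<epsilon> m)"
  unfolding cong_up_to_parity_def
proof
  fix l assume "l \<in> L"
  from term_val_parity[OF assms] this
  have "[term_val \<epsilon> (p - m) l = (if fst l = None then term_val \<epsilon> m l else - term_val \<epsilon> m l)] (mod int p)"
    unfolding cong_up_to_parity_def by blast
  from cong_scalar_left[OF this, of "2 ^ nat_of_pnat (w l)"]
  show "[double_val \<epsilon> (p - m) l =
      (if fst l = None then double_val \<epsilon> m l else - double_val \<epsilon> m l)] (mod int p)"
    by (cases "fst l") (simp_all add: double_val_def)
qed

text \<open>Multiplication by 2 permutes the residues \<open>1, \<dots>, h\<close> up to sign.\<close>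

lemma detm_prod_double:
  "coeffs_cong (int p) B (\<Prod>m\<in>{1..h}. detm L (term_val \<epsilon> m)) (\<Prod>m\<in>{1..h}. detm L (double_val \<epsilon> m))"
proof -
  \<comment> \<open>The representative of 2m or -2m among 1, ..., h.\<close>
  define \<sigma> where "\<sigma> m = (if 2 * m \<le> h then 2 * m else p - 2 * m)" for m
  have "inj_on \<sigma> {1..h}"
  proof (rule inj_onI)
    fix i j assume ij: "i \<in> {1..h}" "j \<in> {1..h}" "\<sigma> i = \<sigma> j"
    then have "i \<le> h" "j \<le> h" by auto
    \<comment> \<open>The two branches cannot collide, because p is odd.\<close>
    moreover have "2 * i \<noteq> p - 2 * j" "p - 2 * i \<noteq> 2 * j"
      using calculation p_eq by presburger+
    ultimately show "i = j"
      using ij(3) p_eq by (simp add: \<sigma>_def split: if_splits)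
  qed
  moreover have "\<sigma> ` {1..h} \<subseteq> {1..h}"
    using p_eq by (auto simp: \<sigma>_def)
  ultimately have \<sigma>: "bij_betw \<sigma> {1..h} {1..h}"
    by (simp add: bij_betw_def endo_inj_surj)
  have "coeffs_cong (int p) B (detm L (term_val \<epsilon> m)) (detm L (double_val \<epsilon> (\<sigma> m)))"
    if m: "m \<in> {1..h}" for m
  proof -
    have mp: "m \<in> {1..<p}" "2 * m < p"
      using m p_eq by auto
    have dv: "double_val \<epsilon> j = (\<lambda>l. \<epsilon> * (2 * modular_inverse (int p) (int j)) ^ nat_of_pnat (w l))" for j
      by (rule ext) (simp add: double_val_def term_val_def power_mult_distrib)
    have tv: "term_val \<epsilon> m = (\<lambda>l. \<epsilon> * modular_inverse (int p) (int m) ^ nat_of_pnat (w l))"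
      by (rule ext) (simp add: term_val_def)
    show ?thesis
    proof (cases "2 * m \<le> h")
      case True
      then have "\<sigma> m = 2 * m"
        by (simp add: \<sigma>_def)
      then show ?thesis
        unfolding dv tv
        by (simp only:) (rule coeffs_cong_detm, rule cong_scalar_left, rule cong_pow,
          rule double_cong[OF mp])
    next
      case False
      then have "\<sigma> m = p - 2 * m"
        by (simp add: \<sigma>_def)
      \<comment> \<open>The sign in this branch is harmless, since the determinant is invariant
        under it.\<close>
      moreover have "[modular_inverse (int p) (int m) =
          - (2 * modular_inverse (int p) (int (p - 2 * m)))] (mod int p)"
        using reflect_cong[OF mp(1), of 2] mp(2) by simp
      ultimately show ?thesis
        unfolding dv tv
        by (simp only:) (rule coeffs_cong_detm_parity, rule cong_up_to_parity_power)
    qed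
  qed
  then have "coeffs_cong (int p) B (\<Prod>m\<in>{1..h}. detm L (term_val \<epsilon> m))
      (\<Prod>m\<in>{1..h}. detm L (double_val \<epsilon> (\<sigma> m)))"
    by (rule coeffs_cong_prod)
  then show ?thesis
    unfolding prod.reindex_bij_betw[OF \<sigma>, of "\<lambda>m. detm L (double_val \<epsilon> m)"] .
qed

text \<open>Two evaluations of one diagonal entry: the transfer matrices give the sum over
  arrangements, the telescoping gives the product of determinants. A general \<open>v\<close> covers
  both \<open>term_val\<close> and \<open>double_val\<close>.\<close>

lemma lookup_prod_detm:
  assumes "\<And>m. m \<in> {1..<p} \<Longrightarrow> cong_up_to_parity (int p) L (v (p - m)) (v m)" "S \<subseteq> L"
  shows "[Poly_Mapping.lookup (\<Prod>m\<in>{1..h}. detm L (v m)) (mset_set S) =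
    (\<Sum>ls\<in>arrangements S True. zsum v (p - 1) ls)] (mod int p)"
proof -
  let ?D = "rev [1..<Suc h]"
  have "coeffs_cong (int p) (mset_set L)
      (foldr (\<lambda>m. act L (v m)) (rev (map (\<lambda>m. p - m) ?D) @ ?D) unit_vec True)
      ((\<Prod>m\<leftarrow>?D. detm L (v m)) * unit_vec True)"
    by (rule foldr_act_parity, rule assms(1)) (use p_eq in \<open>auto simp del: upt_Suc\<close>)
  \<comment> \<open>As \<open>?D\<close> is h, ..., 1, the whole list is p - 1, ..., h + 1, h, ...,
    1.\<close>
  also have "rev (map (\<lambda>m. p - m) ?D) @ ?D = rev [1..<Suc (p - 1)]"
    using upt_reflect(1,3)[OF p_eq] p_eq by (simp del: upt_Suc)
  also have "(\<Prod>m\<leftarrow>?D. detm L (v m)) * unit_vec True = (\<Prod>m\<in>{1..h}. detm L (v m))"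
    by (subst prod.distinct_set_conv_list[symmetric])
      (simp_all add: unit_vec_def atLeastLessThanSuc_atLeastAtMost del: upt_Suc)
  finally show ?thesis
    using coeffs_cong_mset_setD[OF finite_L _ assms(2)] lookup_foldr_act[OF finite_L assms(2)]
    by (metis cong_sym)
qed

text \<open>Every arrangement of \<open>S\<close> uses each letter exactly once, so all of them
  scale by 2 to the total weight of \<open>S\<close>.\<close>

lemma sum_zsum_double:
  assumes "S \<subseteq> L"
  shows "(\<Sum>ls\<in>arrangements S s. zsum (double_val \<epsilon>) n ls) =
    2 ^ (\<Sum>l\<in>S. nat_of_pnat (w l)) * (\<Sum>ls\<in>arrangements S s. zsum (term_val \<epsilon>) n ls)"
proof -
  have "zsum (double_val \<epsilon>) n ls = 2 ^ (\<Sum>l\<in>S. nat_of_pnat (w l)) * zsum (term_val \<epsilon>) n ls"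
    if "ls \<in> arrangements S s" for ls
  proof -
    have "distinct ls" "set ls = S"
      using that by (auto simp: arrangements_def permutations_of_set_def)
    then have "(\<Prod>l\<leftarrow>ls. 2 ^ nat_of_pnat (w l)) = (\<Prod>l\<in>S. 2 ^ nat_of_pnat (w l) :: int)"
      using prod.distinct_set_conv_list[of ls "\<lambda>l. 2 ^ nat_of_pnat (w l) :: int"] by simp
    moreover have "double_val \<epsilon> = (\<lambda>m l. 2 ^ nat_of_pnat (w l) * term_val \<epsilon> m l)"
      by (intro ext) (simp add: double_val_def)
    ultimately show ?thesis
      by (simp add: zsum_scale power_sum)
  qed
  then show ?thesis
    by (simp add: sum_distrib_left)
qed

text \<open>Doubling leaves the product of determinants unchanged, so the sum T satisfies T = 2^K T
  modulo p, where 0 < 2^K - 1 < p. All nonempty subsets and both signs are covered because the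
  starred case needs the whole product for \<open>\<epsilon>\<close> = -1.\<close>

lemma sum_zsum_cong_0:
  assumes "S \<subseteq> L" "S \<noteq> {}"
  shows "[(\<Sum>ls\<in>arrangements S True. zsum (term_val \<epsilon>) (p - 1) ls) = 0] (mod int p)"
proof -
  let ?T = "\<Sum>ls\<in>arrangements S True. zsum (term_val \<epsilon>) (p - 1) ls"
  let ?K = "\<Sum>l\<in>S. nat_of_pnat (w l)"
  have fin: "finite S"
    using assms(1) finite_L finite_subset by blast
  let ?q = "\<lambda>v. Poly_Mapping.lookup (\<Prod>m\<in>{1..h}. detm L (v m)) (mset_set S)"
  have "[?q (term_val \<epsilon>) = ?T] (mod int p)"
    by (rule lookup_prod_detm[where v = "term_val \<epsilon>", OF term_val_parity assms(1)])
  moreover have "[?q (term_val \<epsilon>) = ?q (double_val \<epsilon>)] (mod int p)"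
    by (rule coeffs_cong_mset_setD[OF finite_L detm_prod_double assms(1)])
  moreover have "[?q (double_val \<epsilon>) = 2 ^ ?K * ?T] (mod int p)"
    unfolding sum_zsum_double[OF assms(1), symmetric]
    by (rule lookup_prod_detm[where v = "double_val \<epsilon>", OF double_val_parity assms(1)])
  ultimately have "[2 ^ ?K * ?T = ?T] (mod int p)"
    by (meson cong_sym cong_trans)
  then have "int p dvd (2 ^ ?K - 1) * ?T"
    by (simp add: cong_iff_dvd_diff left_diff_distrib)
  moreover have "\<not> int p dvd 2 ^ ?K - 1"
  proof
    assume dvd: "int p dvd 2 ^ ?K - 1"
    obtain l where "l \<in> S"
      using assms(2) by auto
    then have "0 < ?K"
      using nat_of_pnat[of "w l"] fin by (simp add: sum_pos2[of S l])
    then have "(0 :: int) < 2 ^ ?K - 1"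
      by simp
    from zdvd_imp_le[OF dvd this] have "int p < 2 ^ ?K"
      by simp
    moreover have "?K \<le> (\<Sum>l\<in>L. nat_of_pnat (w l))"
      using assms(1) finite_L by (intro sum_mono2) auto
    then have "(2 :: nat) ^ ?K \<le> 2 ^ (\<Sum>l\<in>L. nat_of_pnat (w l))"
      by simp
    then have "2 ^ ?K < p"
      using p_large by linarith
    then have "(2 :: int) ^ ?K < int p"
      using of_nat_less_iff[of "2 ^ ?K" p, where ?'a = int] by simp
    ultimately show False by simp
  qed
  ultimately show ?thesis
    using prime_p by (simp add: prime_dvd_mult_iff cong_0_iff)
qed

text \<open>The constant coefficient comes from the empty arrangement; all other multilinear ones
  vanish by \<open>sum_zsum_cong_0\<close>.\<close>

lemma prod_detm_cong_1:
  "coeffs_cong (int p) (mset_set L) (\<Prod>m\<in>{1..h}. detm L (term_val \<epsilon> m)) 1"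
proof (rule coeffs_cong_mset_setI[OF finite_L])
  fix S assume S: "S \<subseteq> L"
  then have "[Poly_Mapping.lookup (\<Prod>m\<in>{1..h}. detm L (term_val \<epsilon> m)) (mset_set S) =
      (\<Sum>ls\<in>arrangements S True. zsum (term_val \<epsilon>) (p - 1) ls)] (mod int p)"
    by (intro lookup_prod_detm term_val_parity)
  moreover have "[(\<Sum>ls\<in>arrangements S True. zsum (term_val \<epsilon>) (p - 1) ls) =
      Poly_Mapping.lookup 1 (mset_set S)] (mod int p)"
  proof (cases "S = {}")
    case False
    then show ?thesis
      using sum_zsum_cong_0[OF S] finite_subset[OF S finite_L]
      by (simp add: lookup_one mset_set_empty_iff)
  qed (simp add: lookup_one)
  ultimately show "[Poly_Mapping.lookup (\<Prod>m\<in>{1..h}. detm L (term_val \<epsilon> m)) (mset_set S) =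
      Poly_Mapping.lookup 1 (mset_set S)] (mod int p)"
    by (rule cong_trans)
qed

text \<open>
  With \<open>N m\<close> the off-identity part of the transfer matrix, the starred sums are the coefficients of
  \<open>(1 - N (p - 1))\<inverse> \<cdots> (1 - N 1)\<inverse>\<close>, and \<open>(1 - N 1) \<cdots> (1 - N (p - 1))\<close> is a scalar congruent to 1.
\<close>

definition star_vec :: "nat \<Rightarrow> bool \<Rightarrow> label multiset \<Rightarrow>\<^sub>0 int" where
  "star_vec n s = (\<Sum>S\<in>Pow L. Poly_Mapping.single (mset_set S)
     (\<Sum>ls\<in>arrangements S s. zstar (term_val 1) n ls))"

lemma lookup_star_vec:
  assumes "S \<subseteq> L"
  shows "Poly_Mapping.lookup (star_vec n s) (mset_set S) =
    (\<Sum>ls\<in>arrangements S s. zstar (term_val 1) n ls)"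
proof -
  have "mset_set S' = mset_set S \<longleftrightarrow> S' = S" if "S' \<in> Pow L" for S'
    using that assms finite_L by (metis PowD finite_set_mset_mset_set finite_subset)
  then have "Poly_Mapping.lookup (star_vec n s) (mset_set S) =
      (\<Sum>S'\<in>Pow L. if S' = S then \<Sum>ls\<in>arrangements S' s. zstar (term_val 1) n ls else 0)"
    unfolding star_vec_def lookup_sum lookup_single
    by (intro sum.cong refl) (simp add: when_def)
  then show ?thesis
    using assms finite_L by simp
qed

text \<open>The recursion of \<open>zstar\<close>, solved for its first summand: the factor 1 - N (n
  + 1) cancels the outermost inverse.\<close>

lemma act_star_vec:
  "coeffs_cong (int p) (mset_set L) (act L (term_val (- 1) (Suc n)) (star_vec (Suc n)) s) (star_vec n s)"
proof (rule coeffs_cong_mset_setI[OF finite_L])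
  fix S assume S: "S \<subseteq> L"
  then have fin: "finite S"
    using finite_L finite_subset by blast
  have m1: "term_val (- 1) m l = - term_val 1 m l" for m l
    by (simp add: term_val_def)
  have sub: "S - {l} \<subseteq> L" for l
    using S by blast
  have "(\<Sum>ls\<in>arrangements S s. zstar (term_val 1) (Suc n) ls) +
    (\<Sum>l | l \<in> S \<and> fst l = None. term_val (- 1) (Suc n) l *
      (\<Sum>ls\<in>arrangements (S - {l}) s. zstar (term_val 1) (Suc n) ls)) +
    (\<Sum>l | l \<in> S \<and> fst l = Some s. term_val (- 1) (Suc n) l *
      (\<Sum>ls\<in>arrangements (S - {l}) (\<not> s). zstar (term_val 1) (Suc n) ls)) =
    (\<Sum>ls\<in>arrangements S s. zstar (term_val 1) n ls)"
  proof (cases "S = {}")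
    case False
    show ?thesis
      unfolding sum_arrangements_rec[OF fin False]
      by (simp add: sum.distrib sum_distrib_left m1 sum_negf)
  qed simp
  then have "Poly_Mapping.lookup (act L (term_val (- 1) (Suc n)) (star_vec (Suc n)) s) (mset_set S) =
      Poly_Mapping.lookup (star_vec n s) (mset_set S)"
    unfolding lookup_act[OF finite_L S] lookup_star_vec[OF S] lookup_star_vec[OF sub] .
  then show "[Poly_Mapping.lookup (act L (term_val (- 1) (Suc n)) (star_vec (Suc n)) s) (mset_set S) =
      Poly_Mapping.lookup (star_vec n s) (mset_set S)] (mod int p)"
    by simp
qed

text \<open>The list increases, so the innermost factor has index n and cancels first.\<close>

lemma foldr_act_star_vec:
  "coeffs_cong (int p) (mset_set L)
    (foldr (\<lambda>m. act L (term_val (- 1) m)) [1..<Suc n] (star_vec n) s) (unit_vec s)"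
proof (induction n)
  case 0
  show ?case
  proof (rule coeffs_cong_mset_setI[OF finite_L])
    fix S assume S: "S \<subseteq> L"
    then have fin: "finite S"
      using finite_L finite_subset by blast
    have "zstar (term_val 1) 0 ls = (if ls = [] then 1 else 0)" for ls
      by (cases ls) auto
    moreover have "[] \<in> arrangements S s \<longleftrightarrow> s \<and> S = {}"
      by (auto simp: arrangements_def permutations_of_set_def)
    ultimately show "[Poly_Mapping.lookup (foldr (\<lambda>m. act L (term_val (- 1) m)) [1..<Suc 0] (star_vec 0) s)
        (mset_set S) = Poly_Mapping.lookup (unit_vec s) (mset_set S)] (mod int p)"
      using fin by (simp add: lookup_unit_vec lookup_star_vec[OF S])
  qed
next
  case (Suc n)
  let ?F = "foldr (\<lambda>m. act L (term_val (- 1) m))"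
  have "?F [1..<Suc (Suc n)] (star_vec (Suc n)) =
      ?F [1..<Suc n] (act L (term_val (- 1) (Suc n)) (star_vec (Suc n)))"
    by simp
  moreover have "coeffs_cong (int p) (mset_set L)
      (?F [1..<Suc n] (act L (term_val (- 1) (Suc n)) (star_vec (Suc n))) s) (?F [1..<Suc n] (star_vec n) s)"
    by (intro coeffs_cong_foldr_act act_star_vec)
  ultimately show ?case
    using coeffs_cong_trans[OF _ Suc.IH] by (simp only:)
qed

lemma sum_zstar_cong_0:
  assumes "L \<noteq> {}"
  shows "[(\<Sum>ls\<in>arrangements L True. zstar (term_val 1) (p - 1) ls) = 0] (mod int p)"
proof -
  let ?U = "[Suc h..<p]" and ?B = "mset_set L"
  let ?q = "\<Prod>m\<leftarrow>?U. detm L (term_val (- 1) m)"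
  let ?F = "foldr (\<lambda>m. act L (term_val (- 1) m)) [1..<p] (star_vec (p - 1)) True"
  \<comment> \<open>These determinants belong to the upper half; reflection moves them to the lower
    half, where the product is known to be 1.\<close>
  have "?q = (\<Prod>m\<leftarrow>rev [1..<Suc h]. detm L (term_val (- 1) (p - m)))"
    unfolding upt_reflect(1)[OF p_eq, symmetric] by (simp add: o_def del: upt_Suc)
  also have "\<dots> = (\<Prod>m\<in>{1..h}. detm L (term_val (- 1) (p - m)))"
    by (subst prod.distinct_set_conv_list[symmetric])
      (simp_all add: atLeastLessThanSuc_atLeastAtMost del: upt_Suc)
  also have "coeffs_cong (int p) ?B \<dots> (\<Prod>m\<in>{1..h}. detm L (term_val (- 1) m))"
    by (intro coeffs_cong_prod coeffs_cong_detm_parity term_val_parity) (use p_eq in auto)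
  also have "coeffs_cong (int p) ?B \<dots> 1"
    by (rule prod_detm_cong_1)
  finally have q: "coeffs_cong (int p) ?B ?q 1" .
  \<comment> \<open>The entry \<open>?F\<close> is computed twice: telescoping gives
    \<open>?q\<close> times the entry of \<open>star_vec\<close>, cancellation gives 1.\<close>
  have "coeffs_cong (int p) ?B
      (foldr (\<lambda>m. act L (term_val (- 1) m)) (rev (map (\<lambda>m. p - m) ?U) @ ?U) (star_vec (p - 1)) True)
      (?q * star_vec (p - 1) True)"
    by (rule foldr_act_parity) (use term_val_parity in auto)
  also have "rev (map (\<lambda>m. p - m) ?U) @ ?U = [1..<p]"
    unfolding upt_reflect(2)[OF p_eq] upt_reflect(3)[OF p_eq] by simp
  finally have "coeffs_cong (int p) ?B ?F (?q * star_vec (p - 1) True)" .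
  moreover have "coeffs_cong (int p) ?B ?F 1"
    using foldr_act_star_vec[of "p - 1" True] p_eq by (simp add: unit_vec_def del: upt_Suc)
  moreover have "coeffs_cong (int p) ?B (?q * star_vec (p - 1) True) (star_vec (p - 1) True)"
    using coeffs_cong_mult[OF q coeffs_cong_refl] by simp
  ultimately have "coeffs_cong (int p) ?B (star_vec (p - 1) True) 1"
    by (meson coeffs_cong_sym coeffs_cong_trans)
  from coeffs_cong_mset_setD[OF finite_L this subset_refl] show ?thesis
    using assms finite_L by (simp add: lookup_star_vec lookup_one mset_set_empty_iff)
qed

lemma sum_harmonic_cong_0:
  assumes "L \<noteq> {}"
  defines "v \<equiv> \<lambda>m l. modular_inverse (int p) (int m) ^ nat_of_pnat (w l)"
  shows "[(\<Sum>ls\<in>arrangements L True. zsum v (p - 1) ls) = 0] (mod int p)"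
    and "[(\<Sum>ls\<in>arrangements L True. zstar v (p - 1) ls) = 0] (mod int p)"
proof -
  have "v = term_val 1"
    by (intro ext) (simp add: v_def term_val_def)
  then show "[(\<Sum>ls\<in>arrangements L True. zsum v (p - 1) ls) = 0] (mod int p)"
    and "[(\<Sum>ls\<in>arrangements L True. zstar v (p - 1) ls) = 0] (mod int p)"
    using sum_zsum_cong_0[OF subset_refl assms(1)] sum_zstar_cong_0[OF assms(1)] by simp_all
qed

end

section \<open>Assembly over all large primes\<close>

theorem theorem1p6:
  fixes m n :: nat
  assumes "(m, n) \<noteq> (0, 0)"
    and "abc \<in> I_set m n"
  shows "Z_A (z_tuple abc) = 0 \<and> Zbar_A (z_tuple abc) = 0"
proof -
  obtain a b c where abc: "abc = (a, b, c)"
    by (cases abc)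
  let ?w = "weight (a, b, c)" and ?L = "labels m n"
  let ?v = "\<lambda>p m l. modular_inverse (int p) (int m) ^ nat_of_pnat (?w l)"
  \<comment> \<open>The power of 2 supplies the size condition for the full weight; the summand 2
    ensures p > 2, hence p odd.\<close>
  let ?N = "2 ^ (\<Sum>l\<in>?L. nat_of_pnat (?w l)) + 2 :: nat"
  have len: "length a = m" "length b = m" "length c = n"
    using assms(2) by (auto simp: I_set_def abc)
  have parity: "even (nat_of_pnat (?w l)) \<longleftrightarrow> fst l = None" if "l \<in> ?L" for l
    using that assms(2) by (auto simp: labels_def I_set_def abc)
  have ne: "?L \<noteq> {}"
    using assms(1) by (auto simp: labels_def)
  have z: "z_tuple abc = (\<Sum>ls\<in>arrangements ?L True. word_mon (map ?w ls))"
    using z_tuple_eq_sum_arrangements[OF len(1,2), of c] len(3) abc by simp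
  have zero: "[(\<Sum>ls\<in>arrangements ?L True. zsum (?v p) (p - 1) ls) = 0] (mod int p)"
    "[(\<Sum>ls\<in>arrangements ?L True. zstar (?v p) (p - 1) ls) = 0] (mod int p)"
    if p: "prime p" "?N < p" for p
  proof -
    have "odd p"
      using p by (intro prime_odd_nat) auto
    then obtain h where h: "p = Suc (2 * h)"
      by (auto elim: oddE)
    have large: "2 ^ (\<Sum>l\<in>?L. nat_of_pnat (?w l)) < p"
      using p(2) by linarith
    note cong = sum_harmonic_cong_0[OF p(1) h finite_labels parity large ne]
    show "[(\<Sum>ls\<in>arrangements ?L True. zsum (?v p) (p - 1) ls) = 0] (mod int p)"
      by (rule cong(1))
    show "[(\<Sum>ls\<in>arrangements ?L True. zstar (?v p) (p - 1) ls) = 0] (mod int p)"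
      by (rule cong(2))
  qed
  have "Z_A (z_tuple abc) =
      family_A (\<lambda>p. \<Sum>ls\<in>arrangements ?L True. zsum (?v p) (p - 1) ls)"
    by (simp add: Z_A_def z linear_ext_sum linear_ext_word_mon zeta_A_map sum_family_A)
  also have "\<dots> = 0"
    by (rule family_A_eq_0I[OF zero(1)])
  finally have "Z_A (z_tuple abc) = 0" .
  moreover have "Zbar_A (z_tuple abc) =
      family_A (\<lambda>p. \<Sum>ls\<in>arrangements ?L True. zstar (?v p) (p - 1) ls)"
    by (simp add: Zbar_A_def z linear_ext_sum linear_ext_word_mon zeta_star_A_map sum_family_A)
  then have "Zbar_A (z_tuple abc) = 0"
    using family_A_eq_0I[OF zero(2)] by simp
  ultimately show ?thesis ..
qed

end
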